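(* Let $m\ge s\ge n\ge 1$ be integers, let $X\in\mathbb{R}^{m\times n}$ with $\mathrm{rank}(X)=n$ be a sparse matrix with parameters $(v,t_1,t_2,c_1,c_2)$, and let $\Omega\in\mathbb{R}^{s\times m}$ be an $(\epsilon,p,n)$ oblivious $\ell_2$-subspace embedding, $0\le\epsilon<1$, such that $$\sqrt{\tfrac{1-\epsilon}{1+\epsilon}}\ \ge\ \tfrac{116}{11}\sqrt{mn\mathbf{u}+n(n+1)\mathbf{u}}+\tfrac{3}{88}.$$ Assume $mn\mathbf{u}\le\frac1{64}$ and $n(n+1)\mathbf{u}\le\frac1{64}$. Put $$j=\frac{\sqrt{vt_1c_1^2+nt_2c_2^2}}{\|X\|_2},\qquad k=1.02\,m\mathbf{u}\,\|\Omega\|_F\, j,$$ $$\delta_1=\min\left(\frac{\sqrt{1-\epsilon}}{10.5\,k},\ \frac{1}{10.5\,j\,(\sqrt{1+\epsilon}+1.02\,m\mathbf{u}\,\|\Omega\|_F)}\sqrt{\frac{1-\epsilon}{s\mathbf{u}+(n+1)\mathbf{u}}}\right),$$ $$a=\frac{1.16}{0.88\sqrt{\frac{1-\epsilon}{1+\epsilon}}-0.03},\qquad d=5a^2\,(mn\mathbf{u}+n(n+1)\mathbf{u}),$$ $$b=\frac{1.22+1.24\sqrt{1+d}}{\sqrt{1-\epsilon}}\,(\sqrt{1+\epsilon}+1.02\,m\mathbf{u}\,\|\Omega\|_F)\, j\,n\sqrt n\,\mathbf{u}+\frac{1.24\sqrt{1+d}}{\sqrt{1-\epsilon}}\,(\sqrt{1+\epsilon}+k)\,n^2\mathbf{u}.$$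 Let $Q,R$ be the factors computed in floating-point arithmetic by the algorithm RCholeskyQR2 applied to $X$ with sketching matrix $\Omega$. Then, with probability at least $1-p$ over the choice of $\Omega$, the following holds: if $\kappa_2(X)\le\delta_1$, then $$\|Q^\top Q-I_n\|_F\le d,\qquad \|QR-X\|_F\le b\,\|X\|_2 .$$
   Context: Norms and numbers: $\|\cdot\|_2$ is the spectral norm, $\|\cdot\|_F$ the Frobenius norm, $\sigma_n(X)$ the smallest singular value of $X\in\mathbb{R}^{m\times n}$ ($m\ge n$), and $\kappa_2(X)=\|X\|_2/\sigma_n(X)$. $|A|$ is the entrywise absolute value. Floating-point arithmetic: the standard model with unit roundoff $\mathbf{u}=2^{-53}$ and no overflow or underflow. With $\gamma_n=\frac{n\mathbf{u}}{1-n\mathbf{u}}\ (\le 1.02n\mathbf{u})$, a computed matrix product of inner dimension $n$ satisfies $|AB-fl(AB)|\le\gamma_n|A||B|$; the computed Cholesky factor $R\in\mathbb{R}^{n\times n}$ of $A$, when the factorization runs to completion, satisfies $R^\top R=A+\Delta A$ with $|\Delta A|\le\gamma_{n+1}|R^\top||R|$; and the computed $W$ for $W=XY^{-1}$, with $Y$ upper triangular $n\times n$ and $W$ computed row by row by substitution, satisfies $|WY-X|\le\gamma_n|W||Y|$. Sparse-matrix model: $X\in\mathbb{R}^{m\times n}$ is sparse with parameters $(v,t_1,t_2,c_1,c_2)$ if its columns are divided into $v$ dense columns ($0\le v\ll n$), each with at most $t_1$ non-zero elements, and the remaining sparse columns, each with at most $t_2$ non-zero elements ($0\le t_2\ll t_1$);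 $c_1$ is the largest absolute value of the elements in the dense columns, and $c_2$ the largest absolute value of the elements in the sparse columns. (The relations $\ll$ are qualitative; read them as $v<n$, $t_2<t_1$. If $v=0$ the term $vt_1c_1^2$ is $0$.) Subspace embedding: for $0\le\epsilon<1$, $\Omega\in\mathbb{R}^{s\times m}$ is an $\epsilon$-subspace embedding for a subspace $\mathcal K\subset\mathbb{R}^m$ if $|\langle x,y\rangle-\langle\Omega x,\Omega y\rangle|\le\epsilon\|x\|_2\|y\|_2$ for all $x,y\in\mathcal K$. A random matrix $\Omega$ is an $(\epsilon,p,n)$ oblivious $\ell_2$-subspace embedding if, for every fixed $n$-dimensional subspace $\mathcal K\subset\mathbb{R}^m$, it is an $\epsilon$-subspace embedding for $\mathcal K$ with probability at least $1-p$. Algorithm RCholeskyQR2, every step in floating-point arithmetic: (1) $A=\Omega X$; (2) $G=A^\top A$; (3) $Y=\mathrm{Cholesky}(G)$ (upper triangular, $Y^\top Y\approx G$); (4) $W=XY^{-1}$; (5) $[Q,Z]=\mathrm{CholeskyQR}(W)$, i.e. $C=W^\top W$, $Z=\mathrm{Cholesky}(C)$, $Q=WZ^{-1}$; (6) $R=ZY$. All symbols $A,G,Y,W,C,Z,Q,R$ denote computed quantities. *)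

theory Defs
  imports "HOL-Analysis.Analysis" "HOL-Probability.Probability"
begin

text \<open>
  An m-by-n matrix is a \<^typ>\<open>real ^ 'n ^ 'm\<close>, so \<open>X $ i $ l\<close> is the entry in row i and column l.
  The column index type is linearly ordered where triangularity matters.
\<close>

section \<open>Norms and singular values\<close>

abbreviation spectral_norm :: "real ^ 'n ^ 'm \<Rightarrow> real" where
  "spectral_norm A \<equiv> onorm ((*v) A)"

text \<open>The Euclidean norm of the library on nested vectors is the Frobenius norm.\<close>

abbreviation frobenius_norm :: "real ^ 'n ^ 'm \<Rightarrow> real" where
  "frobenius_norm A \<equiv> norm A"

lemma frobenius_norm_eq:
  "frobenius_norm A = sqrt (\<Sum>i\<in>UNIV. \<Sum>l\<in>UNIV. (A $ i $ l)\<^sup>2)"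
  by (simp add: norm_vec_def L2_set_def sum_nonneg)

definition singular_value :: "real ^ 'n ^ 'm \<Rightarrow> real \<Rightarrow> bool" where
  "singular_value X \<sigma> \<longleftrightarrow>
     0 \<le> \<sigma> \<and> (\<exists>x. x \<noteq> 0 \<and> (transpose X ** X) *v x = \<sigma>\<^sup>2 *\<^sub>R x)"

text \<open>
  All eigenvalues of \<open>transpose X ** X\<close> are taken into account, including zero, so for a matrix
  with at least as many rows as columns this is the n-th (last) singular value.
\<close>

definition sigma_min :: "real ^ 'n ^ 'm \<Rightarrow> real" where
  "sigma_min X = (LEAST \<sigma>. singular_value X \<sigma>)"

definition kappa2 :: "real ^ 'n ^ 'm \<Rightarrow> real" where
  "kappa2 X = spectral_norm X / sigma_min X"

section \<open>Sparse matrices\<close>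

text \<open>
  D is the set of (indices of) dense columns.  The value of \<open>c1\<close> is unconstrained when there is
  no dense column.  The set of sparse columns is never empty, because \<open>v < n\<close>.
\<close>

definition sparse_matrix ::
    "real ^ 'n ^ 'm \<Rightarrow> nat \<Rightarrow> nat \<Rightarrow> nat \<Rightarrow> real \<Rightarrow> real \<Rightarrow> bool" where
  "sparse_matrix X v t1 t2 c1 c2 \<longleftrightarrow>
     v < CARD('n) \<and> t2 < t1 \<and>
     (\<exists>D. card D = v \<and>
        (\<forall>l\<in>D. card {i. X $ i $ l \<noteq> 0} \<le> t1) \<and>
        (\<forall>l\<in>- D. card {i. X $ i $ l \<noteq> 0} \<le> t2) \<and>
        (D \<noteq> {} \<longrightarrow> c1 = Max {\<bar>X $ i $ l\<bar> | i l. l \<in> D}) \<and>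
        c2 = Max {\<bar>X $ i $ l\<bar> | i l. l \<in> - D})"

section \<open>Subspace embeddings\<close>

definition subspace_embedding :: "real \<Rightarrow> real ^ 'm ^ 's \<Rightarrow> (real ^ 'm) set \<Rightarrow> bool" where
  "subspace_embedding \<epsilon> \<Omega> K \<longleftrightarrow>
     (\<forall>x\<in>K. \<forall>y\<in>K. \<bar>x \<bullet> y - (\<Omega> *v x) \<bullet> (\<Omega> *v y)\<bar> \<le> \<epsilon> * norm x * norm y)"

definition oblivious_subspace_embedding ::
    "'w measure \<Rightarrow> ('w \<Rightarrow> real ^ 'm ^ 's) \<Rightarrow> real \<Rightarrow> real \<Rightarrow> nat \<Rightarrow> bool" where
  "oblivious_subspace_embedding M \<Omega> \<epsilon> p n \<longleftrightarrow>
     \<Omega> \<in> borel_measurable M \<and>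
     (\<forall>K. subspace K \<and> dim K = n \<longrightarrow>
        measure M {\<omega> \<in> space M. subspace_embedding \<epsilon> (\<Omega> \<omega>) K} \<ge> 1 - p)"

section \<open>Floating-point arithmetic\<close>

text \<open>
  Computed quantities are described by relations: the last argument of each \<open>fl_\<close> predicate is a
  possible computed result, that is, any matrix obeying the rounding error bound which the standard
  model guarantees for that operation.  No order of summation is fixed.
\<close>

definition unit_roundoff :: real where
  "unit_roundoff = 1 / 2 ^ 53"

definition gamma_fl :: "nat \<Rightarrow> real" where
  "gamma_fl n = real n * unit_roundoff / (1 - real n * unit_roundoff)"

definition mat_abs :: "real ^ 'n ^ 'm \<Rightarrow> real ^ 'n ^ 'm" where
  "mat_abs A = (\<chi> i l. \<bar>A $ i $ l\<bar>)"

definition mat_le :: "real ^ 'n ^ 'm \<Rightarrow> real ^ 'n ^ 'm \<Rightarrow> bool" where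
  "mat_le A B \<longleftrightarrow> (\<forall>i l. A $ i $ l \<le> B $ i $ l)"

definition upper_triangular_mat :: "real ^ 'n::{finite,linorder} ^ 'n::{finite,linorder} \<Rightarrow>
     bool" where
  "upper_triangular_mat R \<longleftrightarrow> (\<forall>i l. l < i \<longrightarrow> R $ i $ l = 0)"

definition fl_mult :: "real ^ 'k ^ 'm \<Rightarrow> real ^ 'n ^ 'k \<Rightarrow> real ^ 'n ^ 'm \<Rightarrow> bool" where
  "fl_mult A B P \<longleftrightarrow>
     mat_le (mat_abs (A ** B - P)) (gamma_fl CARD('k) *\<^sub>R (mat_abs A ** mat_abs B))"

text \<open>
  There is no result when the factorization breaks down; a factorization that runs to completion
  delivers a triangular factor with positive diagonal.
\<close>

definition fl_cholesky ::
    "real ^ 'n::{finite,linorder} ^ 'n::{finite,linorder} \<Rightarrow>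
     real ^ 'n::{finite,linorder} ^ 'n::{finite,linorder} \<Rightarrow>
     bool" where
  "fl_cholesky A R \<longleftrightarrow>
     upper_triangular_mat R \<and> (\<forall>i. 0 < R $ i $ i) \<and>
     (\<exists>\<Delta>A. transpose R ** R = A + \<Delta>A \<and>
        mat_le (mat_abs \<Delta>A)
          (gamma_fl (CARD('n) + 1) *\<^sub>R (mat_abs (transpose R) ** mat_abs R)))"

text \<open>Row-wise substitution for \<open>W = X Y\<inverse>\<close> with upper triangular \<open>Y\<close>.\<close>

definition fl_solve ::
    "real ^ 'n::{finite,linorder} ^ 'm \<Rightarrow>
     real ^ 'n::{finite,linorder} ^ 'n::{finite,linorder} \<Rightarrow>
     real ^ 'n::{finite,linorder} ^ 'm \<Rightarrow>
     bool" where
  "fl_solve X Y W \<longleftrightarrow>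
     upper_triangular_mat Y \<and>
     mat_le (mat_abs (W ** Y - X)) (gamma_fl CARD('n) *\<^sub>R (mat_abs W ** mat_abs Y))"

section \<open>The algorithms\<close>

definition fl_CholeskyQR ::
    "real ^ 'n::{finite,linorder} ^ 'm \<Rightarrow>
     real ^ 'n::{finite,linorder} ^ 'm \<Rightarrow>
     real ^ 'n::{finite,linorder} ^ 'n::{finite,linorder} \<Rightarrow>
     bool" where
  "fl_CholeskyQR W Q Z \<longleftrightarrow>
     (\<exists>C. fl_mult (transpose W) W C \<and> fl_cholesky C Z \<and> fl_solve W Z Q)"

definition fl_RCholeskyQR2 ::
    "real ^ 'm ^ 's \<Rightarrow>
     real ^ 'n::{finite,linorder} ^ 'm \<Rightarrow>
     real ^ 'n::{finite,linorder} ^ 'm \<Rightarrow>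
     real ^ 'n::{finite,linorder} ^ 'n::{finite,linorder} \<Rightarrow>
     bool" where
  "fl_RCholeskyQR2 \<Omega> X Q R \<longleftrightarrow>
     (\<exists>A G Y W Z.
        fl_mult \<Omega> X A \<and>
        fl_mult (transpose A) A G \<and>
        fl_cholesky G Y \<and>
        fl_solve X Y W \<and>
        fl_CholeskyQR W Q Z \<and>
        fl_mult Z Y R)"

end

theory Submission
  imports Defs
begin

text \<open>
  The sketch makes \<open>Y\<close> a good preconditioner: for every \<open>y\<close> the numbers \<open>\<parallel>Y y\<parallel>\<close> and
  \<open>\<parallel>\<Omega> X y\<parallel>\<close> agree up to a factor close to 1, because the bound on the condition number keeps
  all perturbations below a tenth of \<open>sqrt (1 - \<epsilon>) \<sigma>\<^sub>n(X) \<parallel>y\<parallel> \<le> \<parallel>\<Omega> X y\<parallel>\<close>.  As \<open>\<Omega>\<close> nearly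
  preserves norms on the range of \<open>X\<close>, the matrix \<open>X Y\<inverse>\<close>, hence also the computed \<open>W\<close>, has
  condition number at most \<open>a\<close>, and then one step of Cholesky QR yields an almost orthonormal \<open>Q\<close>.
  The residual is the sum \<open>Q R - X = (W Y - X) + (Q Z - W) Y + Q (R - Z Y)\<close> of local errors.
\<close>

section \<open>Spectral and Frobenius norm bounds\<close>

lemma power2_norm_rows: "(norm A)\<^sup>2 = (\<Sum>i\<in>UNIV. (norm (A $ i))\<^sup>2)" for A :: "real ^ 'n ^ 'm"
  by (simp add: norm_vec_def L2_set_def sum_nonneg)

lemma power2_norm_entries: "(norm A)\<^sup>2 = (\<Sum>i\<in>UNIV. \<Sum>l\<in>UNIV. (A $ i $ l)\<^sup>2)"
  for A :: "real ^ 'n ^ 'm"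
  by (simp add: norm_vec_def L2_set_def sum_nonneg)

lemma norm_transpose: "norm (transpose A) = norm A" for A :: "real ^ 'n ^ 'm"
proof -
  have "(norm (transpose A))\<^sup>2 = (norm A)\<^sup>2"
    unfolding power2_norm_entries by (subst sum.swap) (simp add: transpose_def)
  then show ?thesis by (simp add: power2_eq_iff_nonneg)
qed

lemma power2_norm_columns: "(norm A)\<^sup>2 = (\<Sum>l\<in>UNIV. (norm (column l A))\<^sup>2)"
  for A :: "real ^ 'n ^ 'm"
proof -
  have "transpose A $ l = column l A" for l
    by (simp add: transpose_def column_def)
  then show ?thesis
    using power2_norm_rows[of "transpose A"] by (simp add: norm_transpose)
qed

lemma column_matrix_mult: "column l (A ** B) = A *v column l B" for A :: "real ^ 'k ^ 'm"
  by (simp add: column_def matrix_matrix_mult_def matrix_vector_mult_def vec_eq_iff)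

lemma inner_transpose: "(transpose A *v x) \<bullet> y = x \<bullet> (A *v y)" for A :: "real ^ 'n ^ 'm"
  by (simp add: dot_lmul_matrix)

lemma norm_matrix_vector_le: "norm (A *v x) \<le> norm A * norm x" for A :: "real ^ 'n ^ 'm"
proof (rule power2_le_imp_le)
  have "(norm (A *v x))\<^sup>2 = (\<Sum>i\<in>UNIV. (A $ i \<bullet> x)\<^sup>2)"
    by (simp add: matrix_mult_dot norm_vec_def L2_set_def sum_nonneg)
  also have "\<dots> \<le> (\<Sum>i\<in>UNIV. (norm (A $ i))\<^sup>2 * (norm x)\<^sup>2)"
    by (intro sum_mono) (metis Cauchy_Schwarz_ineq power2_norm_eq_inner)
  also have "\<dots> = (norm A * norm x)\<^sup>2"
    by (simp add: power2_norm_rows power_mult_distrib sum_distrib_right)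
  finally show "(norm (A *v x))\<^sup>2 \<le> (norm A * norm x)\<^sup>2" .
qed simp

text \<open>The squared Frobenius norm of a product is the sum over its columns, so a comparison on
  vectors passes to the Frobenius norm with the same factor. With \<open>B = mat 1\<close> this
  compares two matrices of different heights.\<close>

lemma norm_matrix_mult_mono:
  fixes A :: "real ^ 'k ^ 'm" and A' :: "real ^ 'k ^ 'p" and B :: "real ^ 'n ^ 'k"
  assumes "\<And>l. norm (A *v column l B) \<le> c * norm (A' *v column l B)" and "0 \<le> c"
  shows "norm (A ** B) \<le> c * norm (A' ** B)"
proof (rule power2_le_imp_le)
  have "(norm (A ** B))\<^sup>2 = (\<Sum>l\<in>UNIV. (norm (A *v column l B))\<^sup>2)"
    by (simp add: power2_norm_columns column_matrix_mult)
  also have "\<dots> \<le> (\<Sum>l\<in>UNIV. (c * norm (A' *v column l B))\<^sup>2)"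
    by (intro sum_mono power_mono assms) simp
  also have "\<dots> = (c * norm (A' ** B))\<^sup>2"
    by (simp add: power2_norm_columns[of "A' ** B"] column_matrix_mult power_mult_distrib sum_distrib_left)
  finally show "(norm (A ** B))\<^sup>2 \<le> (c * norm (A' ** B))\<^sup>2" .
qed (use assms in auto)

text \<open>Mixed bound: one factor is measured by its action on vectors, only the other one in the
  Frobenius norm. This saves factors \<open>sqrt n\<close> that submultiplicativity would
  cost.\<close>

lemma norm_matrix_mult_left:
  fixes A :: "real ^ 'k ^ 'm" and B :: "real ^ 'n ^ 'k"
  assumes "\<And>x. norm (A *v x) \<le> c * norm x" and "0 \<le> c"
  shows "norm (A ** B) \<le> c * norm B"
  using norm_matrix_mult_mono[of A B c "mat 1"] assms by simp

lemma norm_matrix_mult_le: "norm (A ** B) \<le> norm A * norm B"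
  for A :: "real ^ 'k ^ 'm" and B :: "real ^ 'n ^ 'k"
  by (intro norm_matrix_mult_left norm_matrix_vector_le) simp

text \<open>A matrix and its transpose have the same operator norm: apply Cauchy-Schwarz to the
  square of the left side, written as the inner product of \<open>y\<close> with
  \<open>A *v ?z\<close>, and cancel one factor.\<close>

lemma norm_transpose_vector_le:
  fixes A :: "real ^ 'n ^ 'm"
  assumes "\<And>x. norm (A *v x) \<le> c * norm x"
  shows "norm (transpose A *v y) \<le> c * norm y"
proof (cases "transpose A *v y = 0")
  case True
  \<comment> \<open>A unit vector in the hypothesis shows that \<open>c\<close> cannot be
    negative.\<close>
  have "0 \<le> c * norm (axis undefined 1 :: real ^ 'n)"
    using assms norm_ge_zero order_trans by blast
  then have "0 \<le> c" by simp
  with True show ?thesis by (metis mult_nonneg_nonneg norm_ge_zero norm_zero)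
next
  case False
  let ?z = "transpose A *v y"
  have "(norm ?z)\<^sup>2 = y \<bullet> (A *v ?z)"
    using inner_transpose[of A y ?z] by (simp add: power2_norm_eq_inner)
  also have "\<dots> \<le> norm y * (c * norm ?z)"
    by (meson assms mult_left_mono norm_cauchy_schwarz norm_ge_zero order_trans)
  finally have "norm ?z * norm ?z \<le> (c * norm y) * norm ?z"
    by (simp add: power2_eq_square algebra_simps)
  then show ?thesis using False by (simp add: mult_le_cancel_right)
qed

lemma norm_matrix_mult_right:
  fixes A :: "real ^ 'k ^ 'm" and B :: "real ^ 'n ^ 'k"
  assumes "\<And>x. norm (B *v x) \<le> c * norm x" and "0 \<le> c"
  shows "norm (A ** B) \<le> norm A * c"
proof -
  have "norm (transpose B ** transpose A) \<le> c * norm (transpose A)"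
    by (intro norm_matrix_mult_left norm_transpose_vector_le assms)
  then show ?thesis
    by (metis matrix_transpose_mul mult.commute norm_transpose)
qed

lemma norm_mat_1: "norm (mat 1 :: real ^ 'n ^ 'n) = sqrt CARD('n)"
proof -
  have "(norm (mat 1 :: real ^ 'n ^ 'n))\<^sup>2 = CARD('n)"
    unfolding power2_norm_entries by (simp add: mat_def if_distrib[of "\<lambda>x. x\<^sup>2"] cong: if_cong)
  then show ?thesis by (metis norm_ge_zero real_sqrt_unique)
qed

text \<open>Multiply by the identity, whose Frobenius norm is the root of the dimension.\<close>

lemma norm_le_sqrt_card:
  fixes A :: "real ^ 'n ^ 'm"
  assumes "\<And>x. norm (A *v x) \<le> c * norm x" and "0 \<le> c"
  shows "norm A \<le> sqrt CARD('n) * c"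
  using norm_matrix_mult_left[OF assms, of "mat 1"] by (simp add: norm_mat_1 mult.commute)

section \<open>Operator norms, Gram matrices and inverses\<close>

lemma spectral_norm_bound: "norm (A *v x) \<le> spectral_norm A * norm x"
  for A :: "real ^ 'n ^ 'm"
  by (rule onorm) (simp add: matrix_vector_mul_bounded_linear)

lemma spectral_norm_le_frobenius: "spectral_norm A \<le> norm A" for A :: "real ^ 'n ^ 'm"
  by (rule onorm_le) (rule norm_matrix_vector_le)

lemma trace_gram: "trace (transpose A ** A) = (norm A)\<^sup>2" for A :: "real ^ 'n ^ 'm"
proof -
  have "trace (transpose A ** A) = (\<Sum>l\<in>UNIV. \<Sum>i\<in>UNIV. (A $ i $ l)\<^sup>2)"
    by (simp add: trace_def matrix_matrix_mult_def transpose_def power2_eq_square)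
  then show ?thesis
    unfolding power2_norm_entries by (subst sum.swap) simp
qed

lemma power2_norm_matrix_vector: "(norm (A *v x))\<^sup>2 = x \<bullet> ((transpose A ** A) *v x)"
  for A :: "real ^ 'n ^ 'm"
  using inner_transpose[of A "A *v x" x]
  by (simp only: power2_norm_eq_inner matrix_vector_mul_assoc inner_commute)

text \<open>The difference of the squared norms is the quadratic form of the difference of the Gram
  matrices. This turns a Cholesky backward error into a comparison of two maps on every
  vector.\<close>

lemma norm_gram_diff:
  fixes A :: "real ^ 'n ^ 'm" and B :: "real ^ 'n ^ 'k"
  shows "\<bar>(norm (A *v x))\<^sup>2 - (norm (B *v x))\<^sup>2\<bar>
    \<le> norm (transpose A ** A - transpose B ** B) * (norm x)\<^sup>2"
proof -
  have "(norm (A *v x))\<^sup>2 - (norm (B *v x))\<^sup>2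
      = x \<bullet> ((transpose A ** A - transpose B ** B) *v x)"
    by (simp only: power2_norm_matrix_vector matrix_vector_mult_diff_rdistrib inner_diff_right)
  also have "\<bar>\<dots>\<bar> \<le> norm x * (norm (transpose A ** A - transpose B ** B) * norm x)"
    by (meson Cauchy_Schwarz_ineq2 mult_left_mono norm_ge_zero norm_matrix_vector_le order_trans)
  finally show ?thesis by (simp add: power2_eq_square algebra_simps)
qed

lemma transpose_add: "transpose (A + B) = transpose A + transpose B" for A :: "real ^ 'n ^ 'm"
  by (simp add: transpose_def vec_eq_iff)

lemma matrix_add_rdistrib: "(A + B) ** C = A ** C + B ** C" for A :: "real ^ 'k ^ 'm"
  by (vector matrix_matrix_mult_def sum.distrib[symmetric] field_simps)

lemma matrix_diff_rdistrib: "(A - B) ** C = A ** C - B ** C" for A :: "real ^ 'k ^ 'm"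
  by (vector matrix_matrix_mult_def sum_subtractf[symmetric] field_simps)

lemma matrix_diff_ldistrib: "A ** (B - C) = A ** B - A ** C" for A :: "real ^ 'k ^ 'm"
  by (vector matrix_matrix_mult_def sum_subtractf[symmetric] field_simps)

text \<open>A positive lower bound makes the kernel trivial, and a square matrix is then invertible
  on both sides. Applying the same bound to \<open>Zi *v x\<close> bounds the inverse.\<close>

lemma injective_matrix_inverse:
  fixes Z :: "real ^ 'n ^ 'n"
  assumes "\<And>x. c * norm x \<le> norm (Z *v x)" and "0 < c"
  obtains Zi where "Zi ** Z = mat 1" "Z ** Zi = mat 1" "\<And>x. norm (Zi *v x) \<le> norm x / c"
proof -
  have "Z *v x = 0 \<Longrightarrow> x = 0" for x
    using assms(1)[of x] assms(2) by (simp add: mult_le_0_iff)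
  then obtain Zi where Zi: "Zi ** Z = mat 1"
    using matrix_left_invertible_ker by blast
  then have Zi': "Z ** Zi = mat 1"
    by (simp add: matrix_left_right_inverse)
  have "norm (Zi *v x) \<le> norm x / c" for x
    using assms(1)[of "Zi *v x"] assms(2)
    by (simp add: matrix_vector_mul_assoc Zi' field_simps)
  then show thesis using that Zi Zi' by blast
qed

section \<open>The smallest singular value\<close>

text \<open>The minimum of the norm of \<open>X *v x\<close> over the unit sphere is attained, and
  the first-order condition at a minimiser is the eigenvector equation. Hence the
  \<open>LEAST\<close> in \<open>sigma_min\<close> exists and equals this minimum.\<close>

lemma least_singular_value:
  fixes X :: "real ^ 'n ^ 'm"
  shows "singular_value X (sigma_min X)"
    and "sigma_min X * norm x \<le> norm (X *v x)"
proof -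
  let ?S = "sphere 0 1 :: (real ^ 'n) set"
  have ne: "?S \<noteq> {}"
    by simp
  have cont: "continuous_on ?S (\<lambda>x. norm (X *v x))"
    by (intro continuous_intros linear_continuous_on matrix_vector_mul_bounded_linear)
  obtain x0 where x0: "norm x0 = 1" and min: "\<And>y. norm y = 1 \<Longrightarrow> norm (X *v x0) \<le> norm (X *v y)"
    using continuous_attains_inf[OF compact_sphere ne cont] by auto
  define \<tau> where "\<tau> = norm (X *v x0)"
  have bound: "\<tau> * norm y \<le> norm (X *v y)" for y
  proof (cases "y = 0")
    case False
    then have "\<tau> \<le> norm (X *v (inverse (norm y) *\<^sub>R y))"
      unfolding \<tau>_def by (intro min) simp
    with False show ?thesis
      by (simp add: matrix_vector_mult_scaleR field_simps)
  qed simp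
  \<comment> \<open>Half the gradient at \<open>x0\<close> of the nonnegative function that
    subtracts \<tau> squared times the squared norm of \<open>x\<close> from the squared norm of
    \<open>X *v x\<close>. The function vanishes at \<open>x0\<close>, so the gradient must be
    zero.\<close>
  define g where "g = (transpose X ** X) *v x0 - \<tau>\<^sup>2 *\<^sub>R x0"
  have "g = 0"
  proof (rule ccontr)
    assume "g \<noteq> 0"
    define K where "K = (norm (X *v g))\<^sup>2"
    have quad: "2 * t * (norm g)\<^sup>2 + t\<^sup>2 * K \<ge> 0" for t
    proof -
      have e1: "\<tau>\<^sup>2 * (norm (x0 + t *\<^sub>R g))\<^sup>2 \<le> (norm (X *v (x0 + t *\<^sub>R g)))\<^sup>2"
        using power_mono[OF bound[of "x0 + t *\<^sub>R g"], of 2] by (simp add: \<tau>_def power_mult_distrib)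
      have e2: "(norm (x0 + t *\<^sub>R g))\<^sup>2 = 1 + 2 * t * (x0 \<bullet> g) + t\<^sup>2 * (norm g)\<^sup>2"
        using x0 unfolding power2_norm_eq_inner
        by (simp add: inner_add_left inner_add_right inner_commute power2_eq_square
            norm_eq_1)
      have e3: "(norm (X *v (x0 + t *\<^sub>R g)))\<^sup>2
          = \<tau>\<^sup>2 + 2 * t * ((X *v x0) \<bullet> (X *v g)) + t\<^sup>2 * K"
        unfolding K_def \<tau>_def power2_norm_eq_inner matrix_vector_right_distrib
        by (simp add: inner_add_left inner_add_right inner_commute power2_eq_square
            matrix_vector_mult_scaleR)
      have e4: "(X *v x0) \<bullet> (X *v g) = (norm g)\<^sup>2 + \<tau>\<^sup>2 * (x0 \<bullet> g)"
      proof -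
        have "(X *v x0) \<bullet> (X *v g) = ((transpose X ** X) *v x0) \<bullet> g"
          using inner_transpose[of X "X *v x0" g] by (simp only: matrix_vector_mul_assoc)
        also have "(transpose X ** X) *v x0 = g + \<tau>\<^sup>2 *\<^sub>R x0"
          by (simp add: g_def)
        finally show ?thesis by (simp add: inner_add_left power2_norm_eq_inner)
      qed
      have "2 * t * (norm g)\<^sup>2 + t\<^sup>2 * K \<ge> \<tau>\<^sup>2 * (t\<^sup>2 * (norm g)\<^sup>2)"
        using e1[unfolded e2 e3 e4] by (simp add: algebra_simps)
      then show ?thesis
        by (smt (verit) mult_nonneg_nonneg zero_le_power2)
    qed
    have K: "0 \<le> K" by (simp add: K_def)
    \<comment> \<open>A step against the gradient, short enough that the linear term outweighs the
      quadratic one: this needs \<open>r * K < 2\<close>.\<close>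
    define r where "r = 1 / (K + 1)"
    have r: "0 < r" "r * K < 2"
      using K by (auto simp: r_def field_simps)
    let ?t = "- ((norm g)\<^sup>2 * r)"
    have "2 * ?t * (norm g)\<^sup>2 + ?t\<^sup>2 * K = ((norm g)\<^sup>2)\<^sup>2 * r * (r * K - 2)"
      by (simp add: power2_eq_square algebra_simps)
    also have "\<dots> < 0"
      using r \<open>g \<noteq> 0\<close> by (intro mult_pos_neg) auto
    finally show False using quad[of ?t] by linarith
  qed
  then have sv: "singular_value X \<tau>"
    unfolding singular_value_def g_def using x0 by (auto simp: \<tau>_def intro!: exI[of _ x0])
  have least: "\<tau> \<le> \<rho>" if sv': "singular_value X \<rho>" for \<rho>
  proof -
    obtain y where "0 \<le> \<rho>" "y \<noteq> 0" and y: "(transpose X ** X) *v y = \<rho>\<^sup>2 *\<^sub>R y"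
      using sv' unfolding singular_value_def by blast
    have "(norm (X *v y))\<^sup>2 = y \<bullet> ((transpose X ** X) *v y)"
      by (rule power2_norm_matrix_vector)
    also have "\<dots> = (\<rho> * norm y)\<^sup>2"
      by (simp add: y power2_norm_eq_inner power_mult_distrib)
    finally have "norm (X *v y) = \<rho> * norm y"
      using \<open>0 \<le> \<rho>\<close> by (simp add: power2_eq_iff_nonneg)
    with bound[of y] \<open>y \<noteq> 0\<close> show ?thesis by simp
  qed
  have "sigma_min X = \<tau>"
    unfolding sigma_min_def using sv least by (rule Least_equality)
  with sv bound show "singular_value X (sigma_min X)" "sigma_min X * norm x \<le> norm (X *v x)"
    by auto
qed

lemma sigma_min_pos:
  fixes X :: "real ^ 'n ^ 'm"
  assumes "rank X = CARD('n)"
  shows "0 < sigma_min X"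
proof -
  obtain y where "0 \<le> sigma_min X" "y \<noteq> 0" and y: "(transpose X ** X) *v y = (sigma_min X)\<^sup>2 *\<^sub>R y"
    using least_singular_value(1)[of X] unfolding singular_value_def by blast
  have "sigma_min X \<noteq> 0"
  proof
    assume "sigma_min X = 0"
    then have "(X *v y) \<bullet> (X *v y) = 0"
      using y power2_norm_matrix_vector[of X y] by (simp add: power2_norm_eq_inner)
    then have "X *v y = X *v 0" by simp
    with assms \<open>y \<noteq> 0\<close> show False
      unfolding full_rank_injective by (blast dest: injD)
  qed
  with \<open>0 \<le> sigma_min X\<close> show ?thesis by simp
qed

section \<open>Rounding error bounds in the Frobenius norm\<close>

lemma norm_mono_mat_le:
  assumes "mat_le (mat_abs E) F"
  shows "norm E \<le> norm F"
proof (rule power2_le_imp_le)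
  have "\<bar>E $ i $ l\<bar> \<le> F $ i $ l" for i l
    using assms by (simp add: mat_le_def mat_abs_def)
  then have "(E $ i $ l)\<^sup>2 \<le> (F $ i $ l)\<^sup>2" for i l
    by (metis abs_ge_zero power2_abs power_mono)
  then show "(norm E)\<^sup>2 \<le> (norm F)\<^sup>2"
    unfolding power2_norm_entries by (intro sum_mono)
qed simp

lemma norm_mat_abs: "norm (mat_abs A) = norm A" for A :: "real ^ 'n ^ 'm"
  by (simp add: norm_vec_def L2_set_def mat_abs_def)

text \<open>Entrywise absolute values leave the Frobenius norm unchanged, so passing from
  componentwise to normwise errors costs no dimensional factor.\<close>

lemma norm_rounding_error:
  fixes A :: "real ^ 'k ^ 'm" and B :: "real ^ 'n ^ 'k"
  assumes "mat_le (mat_abs E) (g *\<^sub>R (mat_abs A ** mat_abs B))" and "0 \<le> g"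
  shows "norm E \<le> g * (norm A * norm B)"
proof -
  have "norm E \<le> g * norm (mat_abs A ** mat_abs B)"
    using norm_mono_mat_le[OF assms(1)] assms(2) by simp
  also have "\<dots> \<le> g * (norm A * norm B)"
    using norm_matrix_mult_le[of "mat_abs A" "mat_abs B"] assms(2)
    by (simp add: norm_mat_abs mult_left_mono)
  finally show ?thesis .
qed

text \<open>The diagonal entries of the componentwise bound add up to exactly \<open>g\<close> times
  the squared Frobenius norm.\<close>

lemma trace_rounding_error:
  fixes A :: "real ^ 'n ^ 'm"
  assumes "mat_le (mat_abs E) (g *\<^sub>R (mat_abs (transpose A) ** mat_abs A))"
  shows "\<bar>trace E\<bar> \<le> g * (norm A)\<^sup>2"
proof -
  have "\<bar>trace E\<bar> \<le> (\<Sum>i\<in>UNIV. \<bar>E $ i $ i\<bar>)"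
    unfolding trace_def by (rule sum_abs)
  also have "\<dots> \<le> (\<Sum>i\<in>UNIV. (g *\<^sub>R (mat_abs (transpose A) ** mat_abs A)) $ i $ i)"
    using assms by (intro sum_mono) (auto simp: mat_le_def mat_abs_def)
  also have "\<dots> = g * trace (transpose (mat_abs A) ** mat_abs A)"
    by (simp add: trace_def sum_distrib_left mat_abs_def transpose_def)
  finally show ?thesis
    by (simp add: trace_gram norm_mat_abs)
qed

section \<open>Rounding constants and the norm of a sparse matrix\<close>

lemma unit_roundoff_pos: "0 < unit_roundoff"
  by (simp add: unit_roundoff_def)

lemma gamma_fl_bounds:
  assumes "real k * unit_roundoff \<le> 1 / 64"
  shows "0 \<le> gamma_fl k" and "gamma_fl k \<le> (102 / 100) * (real k * unit_roundoff)"
proof -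
  let ?x = "real k * unit_roundoff"
  have x: "0 \<le> ?x" using unit_roundoff_pos by simp
  then show "0 \<le> gamma_fl k" using assms by (simp add: gamma_fl_def)
  \<comment> \<open>The factor is at least 1 because 1.02 times 63/64 exceeds 1.\<close>
  have "?x * 1 \<le> ?x * ((102 / 100) * (1 - ?x))"
    using assms x by (intro mult_left_mono) auto
  then show "gamma_fl k \<le> (102 / 100) * (real k * unit_roundoff)"
    using assms by (simp add: gamma_fl_def field_simps)
qed

text \<open>Only nonzero entries contribute to a column, so a dense column adds at most
  \<open>t1\<close> squares of size \<open>c1\<close> and a sparse one at most \<open>t2\<close>
  squares of size \<open>c2\<close>.\<close>

lemma sparse_matrix_norm:
  fixes X :: "real ^ 'n::finite ^ 'm::finite"
  assumes "sparse_matrix X v t1 t2 c1 c2"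
  shows "norm X \<le> sqrt (real v * real t1 * c1\<^sup>2 + real CARD('n) * real t2 * c2\<^sup>2)"
proof (rule real_le_rsqrt)
  obtain D where D: "card D = v"
      "\<And>l. l \<in> D \<Longrightarrow> card {i. X $ i $ l \<noteq> 0} \<le> t1"
      "\<And>l. l \<in> - D \<Longrightarrow> card {i. X $ i $ l \<noteq> 0} \<le> t2"
      "D \<noteq> {} \<Longrightarrow> c1 = Max {\<bar>X $ i $ l\<bar> | i l. l \<in> D}"
      "c2 = Max {\<bar>X $ i $ l\<bar> | i l. l \<in> - D}"
    using assms unfolding sparse_matrix_def by blast
  have entry: "\<bar>X $ i $ l\<bar> \<le> Max {\<bar>X $ i $ l\<bar> | i l. l \<in> S}" if "l \<in> S" for i l and S :: "'n set"
  proof (rule Max_ge)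
    show "finite {\<bar>X $ i $ l\<bar> | i l. l \<in> S}"
      by (rule finite_subset[of _ "range (\<lambda>(i, l). \<bar>X $ i $ l\<bar>)"]) auto
  qed (use that in blast)
  have column: "(\<Sum>i\<in>UNIV. (X $ i $ l)\<^sup>2) \<le> real t * c\<^sup>2"
    if "card {i. X $ i $ l \<noteq> 0} \<le> t" and "\<And>i. \<bar>X $ i $ l\<bar> \<le> c" for l t c
  proof -
    have "(\<Sum>i\<in>UNIV. (X $ i $ l)\<^sup>2) = (\<Sum>i | X $ i $ l \<noteq> 0. (X $ i $ l)\<^sup>2)"
      by (rule sum.mono_neutral_right) auto
    also have "\<dots> \<le> real (card {i. X $ i $ l \<noteq> 0}) * c\<^sup>2"
      using that(2) by (intro sum_bounded_above) (metis abs_ge_zero power2_abs power_mono)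
    also have "\<dots> \<le> real t * c\<^sup>2"
      using that(1) by (intro mult_right_mono) auto
    finally show ?thesis .
  qed
  have "(norm X)\<^sup>2 = (\<Sum>l\<in>UNIV. \<Sum>i\<in>UNIV. (X $ i $ l)\<^sup>2)"
    unfolding power2_norm_entries by (rule sum.swap)
  also have "\<dots> = (\<Sum>l\<in>D. \<Sum>i\<in>UNIV. (X $ i $ l)\<^sup>2) + (\<Sum>l\<in>- D. \<Sum>i\<in>UNIV. (X $ i $ l)\<^sup>2)"
    by (subst sum.union_disjoint[symmetric]) auto
  also have "\<dots> \<le> real (card D) * (real t1 * c1\<^sup>2) + real (card (- D)) * (real t2 * c2\<^sup>2)"
  proof (intro add_mono sum_bounded_above column)
    \<comment> \<open>The value of \<open>c1\<close> is fixed only if a dense column exists, which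
      \<open>l \<in> D\<close> guarantees here.\<close>
    show "\<bar>X $ i $ l\<bar> \<le> c1" if "l \<in> D" for i l
      using entry[OF that] D(4) that by auto
    show "\<bar>X $ i $ l\<bar> \<le> c2" if "l \<in> - D" for i l
      using entry[OF that] D(5) by simp
  qed (use D in auto)
  also have "\<dots> \<le> real v * real t1 * c1\<^sup>2 + real CARD('n) * real t2 * c2\<^sup>2"
    using D(1) by (simp add: mult.assoc mult_right_mono card_mono)
  finally show "(norm X)\<^sup>2 \<le> real v * real t1 * c1\<^sup>2 + real CARD('n) * real t2 * c2\<^sup>2" .
qed

section \<open>Cholesky QR\<close>

text \<open>
  Comparing traces in \<open>Y\<^sup>T Y = B\<^sup>T B + E\<close> bounds the Frobenius norm of \<open>Y\<close> by that of
  \<open>B\<close> without a factor depending on the dimension.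
\<close>

lemma gram_cholesky_error:
  fixes B :: "real ^ 'n::{finite,linorder} ^ 'p::finite"
  assumes G: "fl_mult (transpose B) B G" and Y: "fl_cholesky G Y"
    and p: "real CARD('p) * unit_roundoff \<le> 1 / 64"
    and n: "(real CARD('n) + 1) * unit_roundoff \<le> 1 / 64"
  shows "norm Y \<le> (1017 / 1000) * norm B"
    and "norm (transpose Y ** Y - transpose B ** B)
      \<le> (1055 / 1000) * ((real CARD('p) + (real CARD('n) + 1)) * unit_roundoff) * (norm B)\<^sup>2"
proof -
  obtain E where E: "transpose Y ** Y = G + E"
      "mat_le (mat_abs E) (gamma_fl (CARD('n) + 1) *\<^sub>R (mat_abs (transpose Y) ** mat_abs Y))"
    using Y unfolding fl_cholesky_def by blast
  define g1 where "g1 = gamma_fl CARD('p)"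
  define g2 where "g2 = gamma_fl (CARD('n) + 1)"
  have g1: "0 \<le> g1" "g1 \<le> (102 / 100) * (real CARD('p) * unit_roundoff)"
    using gamma_fl_bounds[OF p] by (simp_all add: g1_def)
  have g2: "0 \<le> g2" "g2 \<le> (102 / 100) * ((real CARD('n) + 1) * unit_roundoff)"
    using gamma_fl_bounds[of "CARD('n) + 1"] n by (simp_all add: g2_def add.commute)
  have F: "mat_le (mat_abs (transpose B ** B - G)) (g1 *\<^sub>R (mat_abs (transpose B) ** mat_abs B))"
    using G by (simp add: fl_mult_def g1_def)
  have "trace (transpose B ** B - G) = (norm B)\<^sup>2 - trace G"
    by (simp add: trace_sub trace_gram)
  moreover have "(norm Y)\<^sup>2 = trace G + trace E"
    by (metis E(1) trace_add trace_gram)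
  ultimately have "(norm Y)\<^sup>2 \<le> (norm B)\<^sup>2 + g1 * (norm B)\<^sup>2 + g2 * (norm Y)\<^sup>2"
    using trace_rounding_error[OF F] trace_rounding_error[OF E(2)] by (simp add: g2_def)
  \<comment> \<open>Both rounding factors are at most 1.02/64. The term in \<open>Y\<close> is
    absorbed on the left, and (1 + 1.02/64) / (1 - 1.02/64) is below 1.0324, whose root is below
    1.017.\<close>
  moreover have "g1 * (norm B)\<^sup>2 \<le> ((102 / 100) / 64) * (norm B)\<^sup>2"
    by (rule mult_right_mono) (use g1 p in simp_all)
  moreover have "g2 * (norm Y)\<^sup>2 \<le> ((102 / 100) / 64) * (norm Y)\<^sup>2"
    by (rule mult_right_mono) (use g2 n in simp_all)
  moreover have "0 \<le> (norm B)\<^sup>2" by simp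
  ultimately have YB: "(norm Y)\<^sup>2 \<le> (10324 / 10000) * (norm B)\<^sup>2"
    by linarith
  then have "(norm Y)\<^sup>2 \<le> ((1017 / 1000) * norm B)\<^sup>2"
    unfolding power_mult_distrib
    by (rule order_trans) (intro mult_right_mono, auto simp: power2_eq_square)
  then show "norm Y \<le> (1017 / 1000) * norm B"
    by (rule power2_le_imp_le) simp
  have "norm (transpose Y ** Y - transpose B ** B) = norm (E - (transpose B ** B - G))"
    by (simp add: E(1) diff_diff_eq2 add.commute)
  also have "\<dots> \<le> norm E + norm (transpose B ** B - G)"
    by (rule norm_triangle_ineq4)
  also have "\<dots> \<le> g2 * (norm Y)\<^sup>2 + g1 * (norm B)\<^sup>2"
    using norm_rounding_error[OF F g1(1)] norm_rounding_error[OF E(2)[folded g2_def] g2(1)]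
    by (simp add: norm_transpose power2_eq_square)
  also have "\<dots> \<le> (102 / 100) * ((real CARD('n) + 1) * unit_roundoff) * ((10324 / 10000) * (norm B)\<^sup>2)
      + (102 / 100) * (real CARD('p) * unit_roundoff) * (norm B)\<^sup>2"
    using g1 g2 YB unit_roundoff_pos by (intro add_mono mult_mono) auto
  also have "\<dots> \<le> (1055 / 1000) * ((real CARD('n) + 1) * unit_roundoff * (norm B)\<^sup>2)
      + (1055 / 1000) * (real CARD('p) * unit_roundoff * (norm B)\<^sup>2)"
  proof (rule add_mono)
    have "0 \<le> (real CARD('n) + 1) * unit_roundoff * (norm B)\<^sup>2" "0 \<le> real CARD('p) * unit_roundoff * (norm B)\<^sup>2"
      using unit_roundoff_pos by auto
    then show "(102 / 100) * ((real CARD('n) + 1) * unit_roundoff) * ((10324 / 10000) * (norm B)\<^sup>2)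
        \<le> (1055 / 1000) * ((real CARD('n) + 1) * unit_roundoff * (norm B)\<^sup>2)"
      and "(102 / 100) * (real CARD('p) * unit_roundoff) * (norm B)\<^sup>2
        \<le> (1055 / 1000) * (real CARD('p) * unit_roundoff * (norm B)\<^sup>2)"
      by linarith+
  qed
  also have "\<dots> = (1055 / 1000) * ((real CARD('p) + (real CARD('n) + 1)) * unit_roundoff) * (norm B)\<^sup>2"
    by (simp add: algebra_simps)
  finally show "norm (transpose Y ** Y - transpose B ** B)
      \<le> (1055 / 1000) * ((real CARD('p) + (real CARD('n) + 1)) * unit_roundoff) * (norm B)\<^sup>2" .
qed

section \<open>Normwise solve and product errors, and orthogonality after Cholesky QR\<close>

lemma fl_solve_error:
  fixes X :: "real ^ 'n::{finite,linorder} ^ 'm::finite"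
  assumes "fl_solve X Y W" and "real CARD('n) * unit_roundoff \<le> 1 / 64"
  shows "norm (W ** Y - X) \<le> (102 / 100) * (real CARD('n) * unit_roundoff) * (norm W * norm Y)"
proof -
  have "norm (W ** Y - X) \<le> gamma_fl CARD('n) * (norm W * norm Y)"
    using assms by (intro norm_rounding_error gamma_fl_bounds) (auto simp: fl_solve_def)
  also have "\<dots> \<le> (102 / 100) * (real CARD('n) * unit_roundoff) * (norm W * norm Y)"
    using assms by (intro mult_right_mono gamma_fl_bounds) auto
  finally show ?thesis .
qed

lemma fl_mult_error:
  fixes A :: "real ^ 'k ^ 'm"
  assumes "fl_mult A B P" and "real CARD('k) * unit_roundoff \<le> 1 / 64"
  shows "norm (P - A ** B) \<le> (102 / 100) * (real CARD('k) * unit_roundoff) * (norm A * norm B)"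
proof -
  have "norm (A ** B - P) \<le> gamma_fl CARD('k) * (norm A * norm B)"
    using assms by (intro norm_rounding_error gamma_fl_bounds) (auto simp: fl_mult_def)
  also have "\<dots> \<le> (102 / 100) * (real CARD('k) * unit_roundoff) * (norm A * norm B)"
    using assms by (intro mult_right_mono gamma_fl_bounds) auto
  finally show ?thesis by (simp add: norm_minus_commute)
qed

text \<open>\<open>Z\<close> almost has the Gram matrix of \<open>W\<close>, so the exact quotient
  of \<open>W\<close> by \<open>Z\<close> is almost orthonormal, and the computed \<open>Q\<close>
  differs from it by the solve error. The numbers \<tau> and \<rho> bracket the action of
  \<open>W\<close>, and \<open>a\<close> bounds its condition number.\<close>

lemma cholesky_qr_orthogonality:
  fixes W Q :: "real ^ 'n::{finite,linorder} ^ 'm::finite" and m n \<tau> \<rho> a u q :: real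
  defines "m \<equiv> real CARD('m)" and "n \<equiv> real CARD('n)" and "u \<equiv> unit_roundoff"
  defines "q \<equiv> m * n * u + n * (n + 1) * u"
  assumes alg: "fl_CholeskyQR W Q Z"
    and mnu: "m * n * u \<le> 1 / 64" and nnu: "n * (n + 1) * u \<le> 1 / 64" and nm: "n \<le> m"
    and \<tau>: "0 < \<tau>" "\<And>z. \<tau> * norm z \<le> norm (W *v z)"
    and \<rho>: "\<And>z. norm (W *v z) \<le> \<rho> * norm z"
    and a: "\<rho> \<le> a * \<tau>" "a\<^sup>2 * q \<le> 1 / 64"
  shows "norm (transpose Q ** Q - mat 1) \<le> 5 * a\<^sup>2 * q"
    and "norm Z \<le> (1017 / 1000) * (sqrt n * \<rho>)"
    and "norm (Q ** Z - W) \<le> (102 / 100) * (n * u) * (norm Q * norm Z)"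
proof -
  obtain C where C: "fl_mult (transpose W) W C" "fl_cholesky C Z" "fl_solve W Z Q"
    using alg unfolding fl_CholeskyQR_def by blast
  have u: "0 < u" by (simp add: u_def unit_roundoff_pos)
  have n: "1 \<le> n" by (simp add: n_def)
  have m: "1 \<le> m" by (simp add: m_def)
  have "m * u * 1 \<le> m * u * n"
    using n m u by (intro mult_left_mono) auto
  then have mu: "m * u \<le> 1 / 64" using mnu by (simp add: mult.commute mult.left_commute)
  have "1 * ((n + 1) * u) \<le> n * ((n + 1) * u)"
    using n u by (intro mult_right_mono) auto
  then have nu: "(n + 1) * u \<le> 1 / 64" using nnu by (simp only: mult.assoc mult_1)
  then have nu': "n * u \<le> 1 / 64" using u by (simp add: algebra_simps)
  \<comment> \<open>A unit vector gives \<tau> below \<rho>, hence \<open>a\<close> is at least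
    1.\<close>
  have "\<tau> * norm (axis undefined 1 :: real ^ 'n::{finite,linorder}) \<le> \<rho> * norm (axis undefined 1 :: real ^ 'n::{finite,linorder})"
    by (rule order_trans[OF \<tau>(2) \<rho>])
  then have \<tau>\<rho>: "\<tau> \<le> \<rho>" by simp
  with a have "1 * \<tau> \<le> a * \<tau>" by simp
  then have a1: "1 \<le> a" using \<tau>(1) by (simp only: mult_le_cancel_right_pos)
  define D where "D = a\<^sup>2 * q"
  have q: "0 \<le> q" using n m u by (simp add: q_def)
  then have D: "0 \<le> D" "D \<le> 1 / 64" using a by (auto simp: D_def)
  have W_F: "norm W \<le> sqrt n * \<rho>"
    unfolding n_def using \<rho> \<tau>(1) \<tau>\<rho> by (intro norm_le_sqrt_card) auto
  have Z_F: "norm Z \<le> (1017 / 1000) * norm W"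
    and gram: "norm (transpose Z ** Z - transpose W ** W) \<le> (1055 / 1000) * ((m + (n + 1)) * u) * (norm W)\<^sup>2"
    using gram_cholesky_error[OF C(1,2)] mu nu by (auto simp: m_def n_def u_def)
  show Z_F': "norm Z \<le> (1017 / 1000) * (sqrt n * \<rho>)"
    using Z_F W_F by linarith
  show E: "norm (Q ** Z - W) \<le> (102 / 100) * (n * u) * (norm Q * norm Z)"
    using fl_solve_error[OF C(3)] nu' by (simp add: n_def u_def)
  \<comment> \<open>The factor \<open>n\<close> from the squared Frobenius norm turns
    \<open>(m + (n + 1)) * u\<close> into \<open>q\<close>. The Gram error is then at most 1.055
    times \<open>D\<close> relative to \<tau> squared, the lower bound for \<open>W\<close> on unit
    vectors.\<close>
  have "(norm W)\<^sup>2 \<le> (sqrt n * (a * \<tau>))\<^sup>2"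
    using W_F a(1) n by (intro power_mono) (auto intro: order_trans mult_left_mono)
  then have "(norm W)\<^sup>2 \<le> n * (a\<^sup>2 * \<tau>\<^sup>2)"
    using n by (simp add: power_mult_distrib)
  then have "(1055 / 1000) * ((m + (n + 1)) * u) * (norm W)\<^sup>2 \<le> (1055 / 1000) * ((m + (n + 1)) * u) * (n * (a\<^sup>2 * \<tau>\<^sup>2))"
    using n m u by (intro mult_left_mono) auto
  also have "\<dots> = (1055 / 1000) * D * \<tau>\<^sup>2"
    by (simp add: D_def q_def algebra_simps)
  finally have H: "norm (transpose Z ** Z - transpose W ** W) \<le> (1055 / 1000) * D * \<tau>\<^sup>2"
    using gram by linarith
  have near: "\<bar>(norm (Z *v y))\<^sup>2 - (norm (W *v y))\<^sup>2\<bar> \<le> (165 / 10000) * (\<tau> * norm y)\<^sup>2" for y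
  proof -
    have "(1055 / 1000) * D * \<tau>\<^sup>2 \<le> (165 / 10000) * \<tau>\<^sup>2"
      using D by (intro mult_right_mono) auto
    then have "norm (transpose Z ** Z - transpose W ** W) * (norm y)\<^sup>2 \<le> (165 / 10000) * \<tau>\<^sup>2 * (norm y)\<^sup>2"
      using H by (intro mult_right_mono) auto
    then show ?thesis
      using norm_gram_diff[of Z y W] by (simp add: power_mult_distrib)
  qed
  have W_low: "(\<tau> * norm y)\<^sup>2 \<le> (norm (W *v y))\<^sup>2" for y
    using \<tau> by (intro power_mono) auto
  have "((99 / 100) * (\<tau> * norm y))\<^sup>2 \<le> (norm (Z *v y))\<^sup>2" for y
  proof -
    have "((99 / 100) * (\<tau> * norm y))\<^sup>2 = (9801 / 10000) * (\<tau> * norm y)\<^sup>2"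
      by (simp add: power2_eq_square)
    then show ?thesis
      using near[of y] W_low[of y] zero_le_power2[of "\<tau> * norm y"] by linarith
  qed
  from power2_le_imp_le[OF this] have Z_low: "(99 / 100) * \<tau> * norm y \<le> norm (Z *v y)" for y
    by (simp only: mult.assoc norm_ge_zero)
  have "(norm (W *v y))\<^sup>2 \<le> ((1009 / 1000) * norm (Z *v y))\<^sup>2" for y
  proof -
    have "((1009 / 1000) * norm (Z *v y))\<^sup>2 = (1018081 / 1000000) * (norm (Z *v y))\<^sup>2"
      by (simp add: power2_eq_square)
    then show ?thesis
      using near[of y] W_low[of y] zero_le_power2[of "\<tau> * norm y"] by linarith
  qed
  from power2_le_imp_le[OF this] have WZ: "norm (W *v y) \<le> (1009 / 1000) * norm (Z *v y)" for y
    by simp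
  obtain Zi where Zi: "Zi ** Z = mat 1" "Z ** Zi = mat 1" "\<And>x. norm (Zi *v x) \<le> norm x / ((99 / 100) * \<tau>)"
    using injective_matrix_inverse[of "(99 / 100) * \<tau>" Z] Z_low \<tau>(1) by auto
  \<comment> \<open>\<open>T\<close> is the exact quotient and \<open>P\<close> the effect of the
    solve error.\<close>
  define T where "T = W ** Zi"
  define P where "P = (Q ** Z - W) ** Zi"
  have QTP: "Q = T + P"
    by (simp add: T_def P_def matrix_diff_rdistrib matrix_mul_assoc[symmetric] Zi(2))
  have T: "norm (T *v x) \<le> (1009 / 1000) * norm x" for x
    using WZ[of "Zi *v x"] by (simp add: T_def matrix_vector_mul_assoc Zi(2))
  have Zi_c: "norm (Zi *v x) \<le> 1 / ((99 / 100) * \<tau>) * norm x" for x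
    using Zi(3)[of x] by simp
  have T_F: "norm T \<le> sqrt n * (1009 / 1000)"
    unfolding n_def by (rule norm_le_sqrt_card) (use T in auto)
  have "norm P \<le> norm (Q ** Z - W) * (1 / ((99 / 100) * \<tau>))"
    unfolding P_def by (rule norm_matrix_mult_right[OF Zi_c]) (use \<tau> in auto)
  also have "\<dots> \<le> (102 / 100) * (n * u) * (norm Q * ((1017 / 1000) * (sqrt n * (a * \<tau>)))) * (1 / ((99 / 100) * \<tau>))"
  proof (intro mult_right_mono order_trans[OF E] mult_left_mono)
    have "sqrt n * \<rho> \<le> sqrt n * (a * \<tau>)"
      using a(1) n by (intro mult_left_mono) auto
    then show "norm Z \<le> (1017 / 1000) * (sqrt n * (a * \<tau>))"
      using Z_F' by linarith
  qed (use n u \<tau> in auto)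
  also have "\<dots> = ((102 / 100) * (1017 / 1000) / (99 / 100)) * (n * u * sqrt n * a) * norm Q"
    using \<tau>(1) by (simp add: field_simps)
  also have "\<dots> \<le> (1048 / 1000) * (n * u * sqrt n * a) * norm Q"
    using n u a1 by (intro mult_right_mono) auto
  finally have P_F: "norm P \<le> (1048 / 1000) * (n * u * sqrt n * a) * norm Q" .
  have sq: "sqrt n * sqrt n = n" "1 \<le> sqrt n" "sqrt n \<le> n"
    using n by (auto intro: real_le_lsqrt simp: power2_eq_square)
  \<comment> \<open>Since \<open>n \<le> m\<close>, each summand of \<open>q\<close> dominates
    \<open>n * n * u\<close>. This yields the factor 1/2 in \<open>nnua\<close>, where
    \<open>a \<ge> 1\<close> also allows raising \<open>a\<close> to its square.\<close>
  have "n * n * u \<le> m * n * u" "n * n * u \<le> n * (n + 1) * u"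
    using n u nm by (auto intro!: mult_right_mono)
  then have "2 * (n * n * u) \<le> q"
    by (simp add: q_def)
  then have "2 * (n * n * u) * a \<le> q * a"
    using a1 by (intro mult_right_mono) auto
  also have "\<dots> \<le> q * a * a"
    using a1 q mult_left_mono[of 1 a "q * a"] by simp
  finally have nnua: "n * n * u * a \<le> D / 2"
    by (simp add: D_def power2_eq_square algebra_simps)
  have "n * u * sqrt n * a \<le> n * u * n * a"
    using sq n u a1 by (intro mult_right_mono mult_left_mono) auto
  with nnua D have small: "n * u * sqrt n * a \<le> 1 / 128"
    by (simp add: mult_ac)
  \<comment> \<open>The bound on \<open>P\<close> contains the norm of \<open>Q\<close> itself. As
    1.048/128 is below 0.0082, the triangle inequality can be solved for \<open>Q\<close>, and
    1.009/0.9918 is below 1.02.\<close>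
  have "(1048 / 1000) * (n * u * sqrt n * a) * norm Q \<le> (82 / 10000) * norm Q"
    by (rule mult_right_mono) (use small in linarith, simp)
  then have "norm P \<le> (82 / 10000) * norm Q"
    using P_F by linarith
  moreover have "norm Q \<le> norm T + norm P"
    unfolding QTP by (rule norm_triangle_ineq)
  ultimately have Q_F: "norm Q \<le> (102 / 100) * sqrt n"
    using T_F sq by linarith
  have "norm P \<le> (1048 / 1000) * (n * u * sqrt n * a) * ((102 / 100) * sqrt n)"
    using Q_F n u a1 by (intro order_trans[OF P_F] mult_left_mono) auto
  also have "\<dots> = (1048 / 1000) * (102 / 100) * (n * u * (sqrt n * sqrt n) * a)"
    by (simp only: mult_ac)
  also have "\<dots> = (1048 / 1000) * (102 / 100) * (n * n * u * a)"
    unfolding sq by (simp add: mult_ac)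
  finally have P_D: "norm P \<le> (54 / 100) * D"
    using nnua D by linarith
  \<comment> \<open>Since \<open>Z ** Zi\<close> is the identity, the defect of \<open>T\<close> is
    the Gram error conjugated by \<open>Zi\<close>.\<close>
  have TT: "transpose T ** T - mat 1 = transpose Zi ** ((transpose W ** W - transpose Z ** Z) ** Zi)"
  proof -
    have "transpose Zi ** (transpose Z ** (Z ** Zi)) = transpose (Z ** Zi) ** (Z ** Zi)"
      by (simp add: matrix_transpose_mul matrix_mul_assoc)
    then show ?thesis
      by (simp add: T_def matrix_transpose_mul matrix_diff_ldistrib matrix_diff_rdistrib Zi(2)
          flip: matrix_mul_assoc)
  qed
  have "norm (transpose T ** T - mat 1) \<le> 1 / ((99 / 100) * \<tau>) * norm ((transpose W ** W - transpose Z ** Z) ** Zi)"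
    unfolding TT by (rule norm_matrix_mult_left[OF norm_transpose_vector_le[OF Zi_c]]) (use \<tau> in auto)
  also have "\<dots> \<le> 1 / ((99 / 100) * \<tau>) * (norm (transpose W ** W - transpose Z ** Z) * (1 / ((99 / 100) * \<tau>)))"
    using \<tau> by (intro mult_left_mono norm_matrix_mult_right[OF Zi_c]) auto
  also have "\<dots> \<le> 1 / ((99 / 100) * \<tau>) * (((1055 / 1000) * D * \<tau>\<^sup>2) * (1 / ((99 / 100) * \<tau>)))"
    using \<tau> H by (intro mult_left_mono mult_right_mono) (auto simp: norm_minus_commute)
  also have "\<dots> = (1055 / 1000) / ((99 / 100) * (99 / 100)) * D"
    using \<tau>(1) by (simp add: field_simps power2_eq_square)
  finally have TT_D: "norm (transpose T ** T - mat 1) \<le> (108 / 100) * D"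
    using D by simp
  have "norm (transpose T ** P) \<le> (1009 / 1000) * norm P"
    by (rule norm_matrix_mult_left[OF norm_transpose_vector_le[OF T]]) simp
  moreover have "norm (transpose P ** T) \<le> norm P * (1009 / 1000)"
    using norm_matrix_mult_right[OF T, of "transpose P"] by (simp add: norm_transpose)
  moreover have "norm (transpose P ** P) \<le> norm P * norm P"
    using norm_matrix_mult_le[of "transpose P" P] by (simp add: norm_transpose)
  moreover have "norm P * norm P \<le> 1 * norm P"
    using P_D D by (intro mult_right_mono) auto
  moreover have "transpose Q ** Q - mat 1
      = (transpose T ** T - mat 1) + transpose T ** P + (transpose P ** T + transpose P ** P)"
    by (simp add: QTP transpose_add matrix_add_ldistrib matrix_add_rdistrib)
  then have "norm (transpose Q ** Q - mat 1) \<le> norm (transpose T ** T - mat 1) + norm (transpose T ** P)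
      + (norm (transpose P ** T) + norm (transpose P ** P))"
    by (metis norm_triangle_le add_mono_thms_linordered_semiring(1) norm_triangle_ineq)
  \<comment> \<open>The contributions add up to 1.08 + 2 * 1.009 * 0.54 + 0.54, which is below
    2.8.\<close>
  ultimately have "norm (transpose Q ** Q - mat 1) \<le> 5 * D"
    using TT_D P_D D by linarith
  then show "norm (transpose Q ** Q - mat 1) \<le> 5 * a\<^sup>2 * q"
    by (simp add: D_def)
qed

section \<open>The preconditioned matrix\<close>

text \<open>The hypotheses on \<open>e\<close> and \<alpha> keep the sketching error and the Gram
  error small against \<open>w * \<sigma>\<close>, a lower bound for \<open>\<Omega> ** X\<close> on
  unit vectors. Hence \<open>Y\<close> and \<open>\<Omega> ** X\<close> have comparable norms on
  each vector, and the embedding constants \<open>w\<close> and \<open>w'\<close> carry this over to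
  \<open>X\<close>.\<close>

lemma preconditioned_bounds:
  fixes \<Omega> :: "real ^ 'm::finite ^ 's::finite" and X W :: "real ^ 'n::{finite,linorder} ^ 'm::finite"
    and A :: "real ^ 'n::{finite,linorder} ^ 's::finite" and s n u w w' \<sigma> \<alpha> e :: real
  defines "s \<equiv> real CARD('s)" and "n \<equiv> real CARD('n)" and "u \<equiv> unit_roundoff"
  assumes alg: "fl_mult (transpose A) A G" "fl_cholesky G Y" "fl_solve X Y W"
    and A: "norm (A - \<Omega> ** X) \<le> e" "norm A \<le> \<alpha>"
    and w: "0 < w" "\<And>z. w * norm (X *v z) \<le> norm ((\<Omega> ** X) *v z)"
    and w': "0 < w'" "\<And>z. norm ((\<Omega> ** X) *v z) \<le> w' * norm (X *v z)"
    and \<sigma>: "0 < \<sigma>" "\<And>z. \<sigma> * norm z \<le> norm (X *v z)"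
    and e: "21 * e \<le> 2 * (w * \<sigma>)"
    and \<alpha>: "(21 * \<alpha>)\<^sup>2 * ((s + (n + 1)) * u) \<le> (2 * (w * \<sigma>))\<^sup>2"
    and su: "s * u \<le> 1 / 64" and nnu: "n * (n + 1) * u \<le> 1 / 64" and ns: "n \<le> s"
  shows "norm Y \<le> (1017 / 1000) * \<alpha>"
    and "norm (Y *v z) \<le> (1005 / 1000) * (w' * spectral_norm X + e) * norm z"
    and "norm (W *v z) \<le> (113 / 100) / w * norm z"
    and "((88 / 100) / w' - (3 / 100) / w) * norm z \<le> norm (W *v z)"
proof -
  have u: "0 < u" by (simp add: u_def unit_roundoff_pos)
  have n: "1 \<le> n" by (simp add: n_def)
  have s: "1 \<le> s" by (simp add: s_def)
  have "1 * ((n + 1) * u) \<le> n * ((n + 1) * u)"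
    using n u by (intro mult_right_mono) auto
  then have nu: "(n + 1) * u \<le> 1 / 64" using nnu by (simp only: mult.assoc mult_1)
  then have nu': "n * u \<le> 1 / 64" using u by (simp add: algebra_simps)
  define K where "K = (s + (n + 1)) * u"
  have K: "0 \<le> K" using s n u by (simp add: K_def)
  have Y_F: "norm Y \<le> (1017 / 1000) * norm A"
    and gram: "norm (transpose Y ** Y - transpose A ** A) \<le> (1055 / 1000) * K * (norm A)\<^sup>2"
    using gram_cholesky_error[OF alg(1,2)] su nu by (auto simp: s_def n_def u_def K_def)
  show Y_F': "norm Y \<le> (1017 / 1000) * \<alpha>"
    using Y_F A by linarith
  have \<alpha>0: "0 \<le> \<alpha>" using A(2) norm_ge_zero order_trans by blast
  have e0: "0 \<le> e" using A(1) norm_ge_zero order_trans by blast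
  \<comment> \<open>Here 4/441 is the square of 2/21; times 1.055 it stays below 0.0096.\<close>
  have \<alpha>K: "\<alpha>\<^sup>2 * K \<le> (4 / 441) * (w * \<sigma>)\<^sup>2"
    using \<alpha> by (simp add: K_def power_mult_distrib)
  have "(norm A)\<^sup>2 * K \<le> \<alpha>\<^sup>2 * K"
    using A K by (intro mult_right_mono power_mono) auto
  then have gram': "norm (transpose Y ** Y - transpose A ** A) \<le> (96 / 10000) * (w * \<sigma>)\<^sup>2"
    using gram[unfolded mult.assoc mult.commute[of K]] \<alpha>K zero_le_power2[of "w * \<sigma>"] by linarith
  have t_le: "w * \<sigma> * norm y \<le> norm ((\<Omega> ** X) *v y)" for y
    using w order_trans[OF mult_left_mono[OF \<sigma>(2)[of y], of w] w(2)[of y]]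
    by (simp add: mult.assoc)
  have t0: "0 \<le> w * \<sigma> * norm y" for y using w \<sigma> by simp
  have YA: "\<bar>(norm (Y *v y))\<^sup>2 - (norm (A *v y))\<^sup>2\<bar> \<le> (96 / 10000) * (w * \<sigma> * norm y)\<^sup>2" for y
    using order_trans[OF norm_gram_diff[of Y y A] mult_right_mono[OF gram', of "(norm y)\<^sup>2"]]
    by (simp add: power_mult_distrib)
  have AP: "\<bar>norm (A *v y) - norm ((\<Omega> ** X) *v y)\<bar> \<le> e * norm y" for y
  proof -
    have "\<bar>norm (A *v y) - norm ((\<Omega> ** X) *v y)\<bar> \<le> norm ((A - \<Omega> ** X) *v y)"
      unfolding matrix_vector_mult_diff_rdistrib by (rule norm_triangle_ineq3)
    also have "\<dots> \<le> norm (A - \<Omega> ** X) * norm y"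
      by (rule norm_matrix_vector_le)
    also have "\<dots> \<le> e * norm y"
      using A(1) by (rule mult_right_mono) simp
    finally show ?thesis .
  qed
  have ey: "21 * (e * norm y) \<le> 2 * (w * \<sigma> * norm y)" for y
    using mult_right_mono[OF e, of "norm y"] by (simp add: mult.assoc)
  have P_H: "norm ((\<Omega> ** X) *v y) \<le> (11124 / 10000) * norm (Y *v y)"
    and H_P: "(9 / 10) * norm (Y *v y) \<le> norm ((\<Omega> ** X) *v y)" for y
  proof -
    define P where "P = norm ((\<Omega> ** X) *v y)"
    define H where "H = norm (Y *v y)"
    have P: "0 \<le> P" and H: "0 \<le> H" by (simp_all add: P_def H_def)
    have "(w * \<sigma> * norm y)\<^sup>2 \<le> P\<^sup>2"
      unfolding P_def using t_le t0 by (intro power_mono)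
    then have HA: "\<bar>H\<^sup>2 - (norm (A *v y))\<^sup>2\<bar> \<le> (96 / 10000) * P\<^sup>2"
      using YA[of y] unfolding H_def by linarith
    \<comment> \<open>A perturbation of at most 2/21 of \<open>P\<close> gives the factors 19/21 and
      23/21. Their squares, shifted by 0.0096, yield the constants 1.1124 and 9/10.\<close>
    have "(19 / 21) * P \<le> norm (A *v y)" "norm (A *v y) \<le> (23 / 21) * P"
      using AP[of y] ey[of y] t_le[of y] unfolding P_def by linarith+
    then have "((19 / 21) * P)\<^sup>2 \<le> (norm (A *v y))\<^sup>2" "(norm (A *v y))\<^sup>2 \<le> ((23 / 21) * P)\<^sup>2"
      using P by (intro power_mono; simp)+
    then have A2: "(361 / 441) * P\<^sup>2 \<le> (norm (A *v y))\<^sup>2" "(norm (A *v y))\<^sup>2 \<le> (529 / 441) * P\<^sup>2"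
      by (simp_all add: power2_eq_square)
    have P2: "0 \<le> P\<^sup>2" by simp
    have "((11124 / 10000) * H)\<^sup>2 = (11124 / 10000 * (11124 / 10000)) * H\<^sup>2"
      by (simp add: power2_eq_square)
    then have "P\<^sup>2 \<le> ((11124 / 10000) * H)\<^sup>2"
      using HA A2 P2 by linarith
    then show "P \<le> (11124 / 10000) * H"
      by (rule power2_le_imp_le) (use H in simp)
    have "((9 / 10) * H)\<^sup>2 = (81 / 100) * H\<^sup>2"
      by (simp add: power2_eq_square)
    then have "((9 / 10) * H)\<^sup>2 \<le> P\<^sup>2"
      using HA A2 P2 by linarith
    then show "(9 / 10) * H \<le> P"
      by (rule power2_le_imp_le) (use P in simp)
  qed
  show "norm (Y *v z) \<le> (1005 / 1000) * (w' * spectral_norm X + e) * norm z" for z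
  proof -
    define B where "B = (w' * spectral_norm X + e) * norm z"
    have "norm ((\<Omega> ** X) *v z) \<le> w' * (spectral_norm X * norm z)"
      using w' spectral_norm_bound[of X z] by (meson mult_left_mono order_trans less_imp_le)
    then have P: "norm ((\<Omega> ** X) *v z) + e * norm z \<le> B"
      by (simp add: B_def algebra_simps)
    have "0 \<le> e * norm z" using e0 by simp
    with P have "norm (A *v z) \<le> B" "w * \<sigma> * norm z \<le> B"
      using AP[of z] t_le[of z] by linarith+
    then have "(norm (A *v z))\<^sup>2 \<le> B\<^sup>2" "(w * \<sigma> * norm z)\<^sup>2 \<le> B\<^sup>2"
      using t0[of z] by (auto intro!: power_mono)
    moreover have "((1005 / 1000) * B)\<^sup>2 = (1005 / 1000 * (1005 / 1000)) * B\<^sup>2"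
      by (simp add: power2_eq_square)
    ultimately have "(norm (Y *v z))\<^sup>2 \<le> ((1005 / 1000) * B)\<^sup>2"
      using YA[of z] zero_le_power2[of B] by linarith
    moreover have "0 \<le> B"
      using \<open>norm (A *v z) \<le> B\<close> norm_ge_zero order_trans by blast
    ultimately show ?thesis
      using power2_le_imp_le[of "norm (Y *v z)" "(1005 / 1000) * B"]
      unfolding mult.assoc B_def[symmetric] by simp
  qed
  have Y_low: "(10000 / 11124) * (w * \<sigma>) * norm y \<le> norm (Y *v y)" for y
    using P_H[of y] t_le[of y] by simp
  obtain Yi where Yi: "Y ** Yi = mat 1"
    by (rule injective_matrix_inverse[OF Y_low]) (use w \<sigma> in simp)
  \<comment> \<open>The solve error is proportional to the norm of \<open>W\<close>, which is not
    yet bounded. It is kept as an unknown until an inequality with itself on both sides can be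
    solved.\<close>
  define \<omega> where "\<omega> = spectral_norm W"
  have \<omega>0: "0 \<le> \<omega>"
    unfolding \<omega>_def by (rule onorm_pos_le) (simp add: matrix_vector_mul_bounded_linear)
  have W_F: "norm W \<le> sqrt n * \<omega>"
    unfolding n_def \<omega>_def by (rule norm_le_sqrt_card[OF spectral_norm_bound]) (use \<omega>0 \<omega>_def in simp)
  define h where "h = n * u * sqrt n"
  \<comment> \<open>The bound on \<open>\<alpha>\<close> and \<open>n \<le> s\<close> absorb the dimensional factor \<open>n sqrt n\<close> of the solve error.\<close>
  have "h\<^sup>2 = (n * n * u) * (n * u)"
    using n by (simp add: h_def power2_eq_square)
  also have "\<dots> \<le> (1 / 64) * (K / 2)"
  proof (rule mult_mono)
    have "n * n * u \<le> n * (n + 1) * u" using n u by (intro mult_right_mono mult_left_mono) auto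
    then show "n * n * u \<le> 1 / 64" using nnu by linarith
    have "n * u \<le> ((s + (n + 1)) / 2) * u" using ns u by (intro mult_right_mono) auto
    then show "n * u \<le> K / 2" by (simp add: K_def)
  qed (use n u in auto)
  finally have "\<alpha>\<^sup>2 * h\<^sup>2 \<le> \<alpha>\<^sup>2 * (K / 128)"
    by (intro mult_left_mono) auto
  then have "(\<alpha> * h)\<^sup>2 \<le> (1 / 128) * (4 / 441) * (w * \<sigma>)\<^sup>2"
    using \<alpha>K by (simp add: power_mult_distrib)
  \<comment> \<open>The root of 4 / (441 * 128) is below 0.0085.\<close>
  moreover have "((85 / 10000) * (w * \<sigma>))\<^sup>2 = (85 / 10000 * (85 / 10000)) * (w * \<sigma>)\<^sup>2"
    by (simp add: power2_eq_square)
  ultimately have "(\<alpha> * h)\<^sup>2 \<le> ((85 / 10000) * (w * \<sigma>))\<^sup>2"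
    using zero_le_power2[of "w * \<sigma>"] by linarith
  then have \<alpha>h: "\<alpha> * h \<le> (85 / 10000) * (w * \<sigma>)"
    by (rule power2_le_imp_le) (use w \<sigma> in simp)
  have "norm (W ** Y - X) \<le> (102 / 100) * (n * u) * (norm W * norm Y)"
    using fl_solve_error[OF alg(3)] nu' by (simp add: n_def u_def)
  also have "\<dots> \<le> (102 / 100) * (n * u) * ((sqrt n * \<omega>) * ((1017 / 1000) * \<alpha>))"
    using W_F Y_F' n u \<omega>0 by (intro mult_left_mono mult_mono) auto
  also have "\<dots> = (102 / 100 * (1017 / 1000)) * \<omega> * (\<alpha> * h)"
    by (simp add: h_def)
  also have "\<dots> \<le> (102 / 100 * (1017 / 1000)) * \<omega> * ((85 / 10000) * (w * \<sigma>))"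
    using \<alpha>h \<omega>0 by (intro mult_left_mono) auto
  finally have E: "norm (W ** Y - X) \<le> (102 / 100 * (1017 / 1000) * (85 / 10000)) * (\<omega> * (w * \<sigma>))"
    by (simp add: mult_ac)
  \<comment> \<open>The witness is the preimage of \<open>z\<close> under \<open>Y\<close>, so
    \<open>X *v y\<close> is the value of the exact quotient. The product 1.02 * 1.017 * 0.0085 *
    1.1124 is below 1/100.\<close>
  have W_X: "\<exists>y. norm (W *v z - X *v y) \<le> (1 / 100) * \<omega> * norm z \<and> z = Y *v y" for z
  proof (intro exI conjI)
    let ?y = "Yi *v z"
    show z: "z = Y *v ?y"
      by (simp add: matrix_vector_mul_assoc Yi)
    have "W *v z - X *v ?y = (W ** Y - X) *v ?y"
      by (simp add: matrix_vector_mul_assoc matrix_diff_rdistrib matrix_vector_mult_diff_rdistrib Yi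
          flip: matrix_mul_assoc)
    then have "norm (W *v z - X *v ?y) \<le> norm (W ** Y - X) * norm ?y"
      using norm_matrix_vector_le[of "W ** Y - X" ?y] by simp
    also have "\<dots> \<le> (102 / 100 * (1017 / 1000) * (85 / 10000)) * (\<omega> * (w * \<sigma>)) * norm ?y"
      by (rule mult_right_mono[OF E]) simp
    also have "\<dots> = (102 / 100 * (1017 / 1000) * (85 / 10000)) * (\<omega> * (w * \<sigma> * norm ?y))"
      by (simp only: mult.assoc)
    also have "\<dots> \<le> (102 / 100 * (1017 / 1000) * (85 / 10000)) * (\<omega> * ((11124 / 10000) * norm z))"
      using order_trans[OF t_le P_H, of ?y] \<omega>0 unfolding z[symmetric]
      by (intro mult_left_mono) auto
    also have "\<dots> \<le> (1 / 100) * \<omega> * norm z"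
      using mult_nonneg_nonneg[OF \<omega>0 norm_ge_zero[of z]] by simp
    finally show "norm (W *v z - X *v ?y) \<le> (1 / 100) * \<omega> * norm z" .
  qed
  have "norm (W *v z) \<le> ((11124 / 10000) / w + (1 / 100) * \<omega>) * norm z" for z
  proof -
    obtain y where y: "norm (W *v z - X *v y) \<le> (1 / 100) * \<omega> * norm z" "z = Y *v y"
      using W_X by blast
    have "norm (X *v y) \<le> (11124 / 10000) / w * norm z"
      using order_trans[OF w(2)[of y] P_H[of y]] w(1) y(2) by (simp add: field_simps)
    then show ?thesis
      using y(1) norm_triangle_sub[of "W *v z" "X *v y"] by (simp add: algebra_simps)
  qed
  \<comment> \<open>Now the self-referential inequality is solved: 1.1124/0.99 is below
    1.13.\<close>
  then have "\<omega> \<le> (11124 / 10000) / w + (1 / 100) * \<omega>"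
    unfolding \<omega>_def by (rule onorm_le)
  moreover define r where "r = 1 / w"
  ultimately have "\<omega> \<le> (11124 / 10000) * r + (1 / 100) * \<omega>"
    by simp
  moreover have "0 < r" using w by (simp add: r_def)
  ultimately have "\<omega> \<le> (113 / 100) * r"
    by linarith
  then have \<omega>: "\<omega> \<le> (113 / 100) / w" by (simp add: r_def)
  show "norm (W *v z) \<le> (113 / 100) / w * norm z" for z
    using spectral_norm_bound[of W z] \<omega> unfolding \<omega>_def
    by (meson mult_right_mono norm_ge_zero order_trans)
  show "((88 / 100) / w' - (3 / 100) / w) * norm z \<le> norm (W *v z)" for z
  proof -
    obtain y where y: "norm (W *v z - X *v y) \<le> (1 / 100) * \<omega> * norm z" "z = Y *v y"
      using W_X by blast
    have "(9 / 10) * norm z \<le> w' * norm (X *v y)"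
      using order_trans[OF H_P[of y] w'(2)[of y]] y(2) by simp
    then have "(9 / 10) / w' * norm z \<le> norm (X *v y)"
      using w'(1) by (simp add: field_simps)
    moreover have "(1 / 100) * \<omega> * norm z \<le> (1 / 100) * ((113 / 100) / w) * norm z"
      using \<omega> by (intro mult_right_mono mult_left_mono) auto
    ultimately have "((9 / 10) / w' - (1 / 100) * ((113 / 100) / w)) * norm z \<le> norm (W *v z)"
      using y(1) norm_triangle_sub[of "X *v y" "W *v z"]
      by (simp add: left_diff_distrib norm_minus_commute)
    moreover have "(88 / 100) / w' - (3 / 100) / w \<le> (9 / 10) / w' - (1 / 100) * ((113 / 100) / w)"
      using w w' by (intro diff_mono) (simp_all add: field_simps)
    ultimately show ?thesis
      by (meson mult_right_mono norm_ge_zero order_trans)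
  qed
qed

text \<open>The deterministic core, for one fixed sketch with distortion constants \<open>w\<close>
  and \<open>w'\<close>. Here \<open>J\<close> bounds the Frobenius norm of \<open>X\<close>,
  \<open>e\<close> the rounding error of the sketch and \<alpha> the Frobenius norm of the computed
  sketch.\<close>

lemma RCholeskyQR2_error:
  fixes \<Omega> :: "real ^ 'm::finite ^ 's::finite" and X Q :: "real ^ 'n::{finite,linorder} ^ 'm::finite"
    and m s n u q w w' \<sigma> J e \<alpha> a d :: real
  defines "m \<equiv> real CARD('m)" and "s \<equiv> real CARD('s)" and "n \<equiv> real CARD('n)"
    and "u \<equiv> unit_roundoff"
  defines "q \<equiv> m * n * u + n * (n + 1) * u" and "d \<equiv> 5 * a\<^sup>2 * (m * n * u + n * (n + 1) * u)"
  defines "e \<equiv> (102 / 100) * m * u * norm \<Omega> * J"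
    and "\<alpha> \<equiv> (w' + (102 / 100) * m * u * norm \<Omega>) * J"
  assumes alg: "fl_RCholeskyQR2 \<Omega> X Q R"
    and mnu: "m * n * u \<le> 1 / 64" and nnu: "n * (n + 1) * u \<le> 1 / 64"
    and ns: "n \<le> s" and sm: "s \<le> m"
    and w: "0 < w" "\<And>z. w * norm (X *v z) \<le> norm (\<Omega> *v (X *v z))"
    and w': "0 < w'" "\<And>z. norm (\<Omega> *v (X *v z)) \<le> w' * norm (X *v z)"
    and \<sigma>: "0 < \<sigma>" "\<And>z. \<sigma> * norm z \<le> norm (X *v z)"
    and J: "norm X \<le> J"
    and e: "21 * e \<le> 2 * (w * \<sigma>)"
    and \<alpha>: "(21 * \<alpha>)\<^sup>2 * ((s + (n + 1)) * u) \<le> (2 * (w * \<sigma>))\<^sup>2"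
    and a: "(116 / 100) / w \<le> a * ((88 / 100) / w' - (3 / 100) / w)" "(3 / 100) / w < (88 / 100) / w'"
      "a\<^sup>2 * q \<le> 1 / 64"
  shows "norm (transpose Q ** Q - mat 1) \<le> d"
    and "norm (Q ** R - X)
      \<le> ((122 / 100) + (124 / 100) * sqrt (1 + d)) / w * \<alpha> * (n * sqrt n * u)
        + (124 / 100) * sqrt (1 + d) / w * (w' * spectral_norm X + e) * (n\<^sup>2 * u)"
proof -
  obtain A G Y W Z where A: "fl_mult \<Omega> X A" and G: "fl_mult (transpose A) A G" "fl_cholesky G Y"
      "fl_solve X Y W" and W: "fl_CholeskyQR W Q Z" and R: "fl_mult Z Y R"
    using alg unfolding fl_RCholeskyQR2_def by blast
  have u: "0 < u" by (simp add: u_def unit_roundoff_pos)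
  have n: "1 \<le> n" by (simp add: n_def)
  have m: "1 \<le> m" by (simp add: m_def)
  have "m * u * 1 \<le> m * u * n"
    using n m u by (intro mult_left_mono) auto
  then have mu: "m * u \<le> 1 / 64" using mnu by (simp add: mult.commute mult.left_commute)
  have "s * u \<le> m * u" "n * u \<le> m * u"
    using sm ns u by (auto intro!: mult_right_mono)
  then have su: "s * u \<le> 1 / 64" and nu: "n * u \<le> 1 / 64" using mu by linarith+
  have q: "0 \<le> q" using n m u by (simp add: q_def)
  have d: "d = 5 * a\<^sup>2 * q" "0 \<le> d"
    using q by (simp_all add: d_def q_def)
  have J0: "0 \<le> J" using J norm_ge_zero order_trans by blast
  have "norm (A - \<Omega> ** X) \<le> (102 / 100) * (m * u) * (norm \<Omega> * norm X)"
    using fl_mult_error[OF A] mu by (simp add: m_def u_def)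
  also have "\<dots> \<le> (102 / 100) * (m * u) * (norm \<Omega> * J)"
    using J m u by (intro mult_left_mono) auto
  finally have AX: "norm (A - \<Omega> ** X) \<le> e"
    by (simp add: e_def mult.assoc)
  have w'X: "norm (\<Omega> ** X *v z) \<le> w' * norm (X *v z)"
    and wX: "w * norm (X *v z) \<le> norm (\<Omega> ** X *v z)" for z
    using w(2) w'(2) by (simp_all add: matrix_vector_mul_assoc)
  have "norm (\<Omega> ** X) \<le> w' * norm X"
    using norm_matrix_mult_mono[of "\<Omega> ** X" "mat 1" w' X] w'X w'(1) by simp
  also have "\<dots> \<le> w' * J" using J w' by simp
  finally have "norm A \<le> w' * J + e"
    using AX norm_triangle_sub[of A "\<Omega> ** X"] by linarith
  then have A_F: "norm A \<le> \<alpha>" by (simp add: \<alpha>_def e_def algebra_simps)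
  have \<alpha>0: "0 \<le> \<alpha>" using A_F norm_ge_zero order_trans by blast
  note pre = preconditioned_bounds[OF G AX A_F w(1) wX w'(1) w'X \<sigma> e, folded n_def s_def u_def,
      OF \<alpha> su nnu ns]
  define \<tau> where "\<tau> = (88 / 100) / w' - (3 / 100) / w"
  have \<tau>: "0 < \<tau>" using a by (simp add: \<tau>_def)
  have "(113 / 100) / w \<le> (116 / 100) / w" by (rule divide_right_mono) (use w in simp_all)
  with a have \<rho>\<tau>: "(113 / 100) / w \<le> a * \<tau>" by (simp add: \<tau>_def)
  have nm: "n \<le> m" using ns sm by simp
  note qr = cholesky_qr_orthogonality[OF W, folded m_def n_def u_def, folded q_def,
      OF mnu nnu nm \<tau> pre(4)[folded \<tau>_def] pre(3) \<rho>\<tau> a(3)]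
  show QQ: "norm (transpose Q ** Q - mat 1) \<le> d"
    using qr(1) by (simp add: d)
  \<comment> \<open>Closeness of the Gram matrix of \<open>Q\<close> to the identity bounds the
    action of \<open>Q\<close> on vectors by \<open>sqrt (1 + d)\<close>.\<close>
  define r where "r = sqrt (1 + d)"
  have r: "0 \<le> r" "r\<^sup>2 = 1 + d" using d by (simp_all add: r_def)
  have Q: "norm (Q *v x) \<le> r * norm x" for x
  proof (rule power2_le_imp_le)
    have "norm (transpose Q ** Q - mat 1) * (norm x)\<^sup>2 \<le> d * (norm x)\<^sup>2"
      using QQ by (rule mult_right_mono) simp
    then show "(norm (Q *v x))\<^sup>2 \<le> (r * norm x)\<^sup>2"
      using norm_gram_diff[of Q x "mat 1"] by (simp add: power_mult_distrib r distrib_right)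
  qed (use r in simp)
  have Q_F: "norm Q \<le> sqrt n * r"
    unfolding n_def by (rule norm_le_sqrt_card[OF Q r(1)])
  have sq: "0 \<le> sqrt n" "sqrt n * sqrt n = n" using n by auto
  define \<beta> where "\<beta> = w' * spectral_norm X + e"
  have e0: "0 \<le> e" using AX norm_ge_zero order_trans by blast
  have \<beta>: "0 \<le> \<beta>"
    using e0 w' onorm_pos_le[of "(*v) X"]
    by (simp add: \<beta>_def matrix_vector_mul_bounded_linear)
  have W_F: "norm W \<le> sqrt n * ((113 / 100) / w)"
    unfolding n_def by (rule norm_le_sqrt_card[OF pre(3)]) (use w in simp)
  have "norm (W ** Y - X) \<le> (102 / 100) * (n * u) * (norm W * norm Y)"
    using fl_solve_error[OF G(3)] nu by (simp add: n_def u_def)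
  also have "\<dots> \<le> (102 / 100) * (n * u) * ((sqrt n * ((113 / 100) / w)) * ((1017 / 1000) * \<alpha>))"
    using W_F pre(1) n u w by (intro mult_left_mono mult_mono) auto
  also have "\<dots> = (102 / 100 * (113 / 100) * (1017 / 1000)) * (\<alpha> * (n * sqrt n * u) / w)"
    by simp
  also have "\<dots> \<le> (122 / 100) * (\<alpha> * (n * sqrt n * u) / w)"
    using \<alpha>0 n u w by (intro mult_right_mono) auto
  finally have err1: "norm (W ** Y - X) \<le> (122 / 100) * (\<alpha> * (n * sqrt n * u) / w)" .
  \<comment> \<open>Here \<open>Y\<close> enters through its operator bound, while \<open>Q\<close>
    and \<open>Z\<close> each contribute a factor \<open>sqrt n\<close>; this produces the term with
    \<open>n\<^sup>2\<close>.\<close>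
  have "norm ((Q ** Z - W) ** Y) \<le> norm (Q ** Z - W) * ((1005 / 1000) * \<beta>)"
    by (rule norm_matrix_mult_right[OF pre(2)[folded \<beta>_def]]) (use \<beta> in simp)
  also have "\<dots> \<le> (102 / 100) * (n * u)
      * ((sqrt n * r) * ((1017 / 1000) * (sqrt n * ((113 / 100) / w)))) * ((1005 / 1000) * \<beta>)"
    using Q_F qr(2) n u w r \<beta>
    by (intro mult_right_mono order_trans[OF qr(3)] mult_left_mono mult_mono) auto
  also have "\<dots> = (102 / 100 * (1017 / 1000) * (113 / 100) * (1005 / 1000))
      * (r * \<beta> * (n * (sqrt n * sqrt n) * u) / w)"
    by (simp del: real_sqrt_mult_self)
  also have "\<dots> \<le> (124 / 100) * (r * \<beta> * (n * (sqrt n * sqrt n) * u) / w)"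
    using \<beta> r n u w by (intro mult_right_mono) auto
  finally have err2: "norm ((Q ** Z - W) ** Y) \<le> (124 / 100) * (r * \<beta> * (n\<^sup>2 * u) / w)"
    unfolding sq power2_eq_square .
  \<comment> \<open>Now \<open>Q\<close> enters through its operator bound and \<open>Y\<close>
    through \<alpha>, so the only \<open>sqrt n\<close> comes from \<open>Z\<close>.\<close>
  have "norm (Q ** (R - Z ** Y)) \<le> r * norm (R - Z ** Y)"
    by (rule norm_matrix_mult_left[OF Q r(1)])
  also have "\<dots> \<le> r * ((102 / 100) * (n * u) * (norm Z * norm Y))"
    using fl_mult_error[OF R] nu r by (intro mult_left_mono) (auto simp: n_def u_def)
  also have "\<dots> \<le> r * ((102 / 100) * (n * u)
      * (((1017 / 1000) * (sqrt n * ((113 / 100) / w))) * ((1017 / 1000) * \<alpha>)))"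
    using qr(2) pre(1) n u w r by (intro mult_left_mono mult_mono) auto
  also have "\<dots> = (102 / 100 * (1017 / 1000) * (113 / 100) * (1017 / 1000)) * (r * \<alpha> * (n * sqrt n * u) / w)"
    by simp
  also have "\<dots> \<le> (124 / 100) * (r * \<alpha> * (n * sqrt n * u) / w)"
    using \<alpha>0 r n u w by (intro mult_right_mono) auto
  finally have err3: "norm (Q ** (R - Z ** Y)) \<le> (124 / 100) * (r * \<alpha> * (n * sqrt n * u) / w)" .
  have split: "Q ** R - X = (W ** Y - X) + ((Q ** Z - W) ** Y + Q ** (R - Z ** Y))"
    by (simp add: matrix_diff_rdistrib matrix_diff_ldistrib matrix_mul_assoc)
  have "norm (Q ** R - X) \<le> norm (W ** Y - X) + (norm ((Q ** Z - W) ** Y) + norm (Q ** (R - Z ** Y)))"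
    unfolding split using norm_triangle_ineq[of "W ** Y - X" "(Q ** Z - W) ** Y + Q ** (R - Z ** Y)"]
      norm_triangle_ineq[of "(Q ** Z - W) ** Y" "Q ** (R - Z ** Y)"] by linarith
  also have "\<dots> \<le> (122 / 100) * (\<alpha> * (n * sqrt n * u) / w) + ((124 / 100) * (r * \<beta> * (n\<^sup>2 * u) / w)
      + (124 / 100) * (r * \<alpha> * (n * sqrt n * u) / w))"
    by (intro add_mono err1 err2 err3)
  also have "\<dots> = ((122 / 100) + (124 / 100) * r) / w * \<alpha> * (n * sqrt n * u)
        + (124 / 100) * r / w * \<beta> * (n\<^sup>2 * u)"
    using w(1) by (simp add: field_simps)
  finally show "norm (Q ** R - X)
      \<le> ((122 / 100) + (124 / 100) * sqrt (1 + d)) / w * \<alpha> * (n * sqrt n * u)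
        + (124 / 100) * sqrt (1 + d) / w * (w' * spectral_norm X + e) * (n\<^sup>2 * u)"
    by (simp add: r_def \<beta>_def)
qed

section \<open>From the embedding event to the deterministic bounds\<close>

theorem theorem3p3:
  fixes X :: "real ^ 'n::{finite,linorder} ^ 'm::finite"
    and M :: "'w measure"
    and \<Omega> :: "'w \<Rightarrow> real ^ 'm ^ 's::finite"
    and m s n v t1 t2 :: nat
    and c1 c2 \<epsilon> p u j a d :: real
    and k \<delta>1 b :: "'w \<Rightarrow> real"
  assumes dims: "m = CARD('m)" "s = CARD('s)" "n = CARD('n)"
    and "m \<ge> s" "s \<ge> n" "n \<ge> 1"
    and u: "u = unit_roundoff"
    and "rank X = n"
    and "sparse_matrix X v t1 t2 c1 c2"
    and "prob_space M"
    and "0 \<le> \<epsilon>" "\<epsilon> < 1"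
    and "oblivious_subspace_embedding M \<Omega> \<epsilon> p n"
    and "sqrt ((1 - \<epsilon>) / (1 + \<epsilon>))
           \<ge> 116 / 11 * sqrt (real m * real n * u + real n * (real n + 1) * u) + 3 / 88"
    and "real m * real n * u \<le> 1 / 64"
    and "real n * (real n + 1) * u \<le> 1 / 64"
    and j: "j = sqrt (real v * real t1 * c1\<^sup>2 + real n * real t2 * c2\<^sup>2) / spectral_norm X"
    and k: "\<And>\<omega>. k \<omega> = 1.02 * real m * u * frobenius_norm (\<Omega> \<omega>) * j"
    and \<delta>1: "\<And>\<omega>. \<delta>1 \<omega> =
          min (sqrt (1 - \<epsilon>) / (10.5 * k \<omega>))
              (1 / (10.5 * j * (sqrt (1 + \<epsilon>) + 1.02 * real m * u * frobenius_norm (\<Omega> \<omega>)))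
                 * sqrt ((1 - \<epsilon>) / (real s * u + (real n + 1) * u)))"
    and a: "a = 1.16 / (0.88 * sqrt ((1 - \<epsilon>) / (1 + \<epsilon>)) - 0.03)"
    and d: "d = 5 * a\<^sup>2 * (real m * real n * u + real n * (real n + 1) * u)"
    and b: "\<And>\<omega>. b \<omega> =
          (1.22 + 1.24 * sqrt (1 + d)) / sqrt (1 - \<epsilon>)
              * (sqrt (1 + \<epsilon>) + 1.02 * real m * u * frobenius_norm (\<Omega> \<omega>))
              * j * real n * sqrt (real n) * u
          + 1.24 * sqrt (1 + d) / sqrt (1 - \<epsilon>) * (sqrt (1 + \<epsilon>) + k \<omega>) * (real n)\<^sup>2 * u"
  shows "\<exists>E \<in> sets M. measure M E \<ge> 1 - p \<and>
           (\<forall>\<omega>\<in>E. \<forall>Q R. fl_RCholeskyQR2 (\<Omega> \<omega>) X Q R \<longrightarrow> kappa2 X \<le> \<delta>1 \<omega> \<longrightarrow>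
              frobenius_norm (transpose Q ** Q - mat 1) \<le> d \<and>
              frobenius_norm (Q ** R - X) \<le> b \<omega> * spectral_norm X)"
proof -
  define N where "N = spectral_norm X"
  define J where "J = sqrt (real v * real t1 * c1\<^sup>2 + real n * real t2 * c2\<^sup>2)"
  define w where "w = sqrt (1 - \<epsilon>)"
  define w' where "w' = sqrt (1 + \<epsilon>)"
  define \<sigma> where "\<sigma> = sigma_min X"
  define q where "q = real m * real n * u + real n * (real n + 1) * u"
  have u0: "0 < u" by (simp add: u unit_roundoff_pos)
  have w: "0 < w" "w\<^sup>2 = 1 - \<epsilon>" and w': "0 < w'" "w'\<^sup>2 = 1 + \<epsilon>"
    using assms(11,12) by (simp_all add: w_def w'_def)
  have \<sigma>: "0 < \<sigma>" "\<And>z. \<sigma> * norm z \<le> norm (X *v z)"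
    unfolding \<sigma>_def using sigma_min_pos least_singular_value(2) assms(8) dims by auto
  have XJ: "norm X \<le> J"
    unfolding J_def dims(3) by (rule sparse_matrix_norm[OF assms(9)])
  have N: "0 < N"
  proof -
    have "\<sigma> * norm (axis undefined 1 :: real ^ 'n::{finite,linorder}) \<le> N * norm (axis undefined 1 :: real ^ 'n::{finite,linorder})"
      unfolding N_def by (rule order_trans[OF \<sigma>(2) spectral_norm_bound])
    with \<sigma>(1) show ?thesis by simp
  qed
  have J0: "0 < J"
    using N XJ spectral_norm_le_frobenius[of X] unfolding N_def by linarith
  have jN: "j * N = J" and j0: "0 < j"
    using N J0 by (simp_all add: j N_def[symmetric] J_def[symmetric])
  have q0: "0 < q"
    using u0 assms(6) dims by (simp add: q_def add_nonneg_pos)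
  have ratio: "sqrt ((1 - \<epsilon>) / (1 + \<epsilon>)) = w / w'"
    by (simp add: w_def w'_def real_sqrt_divide)
  \<comment> \<open>The denominator of \<open>a\<close>. Multiplying the assumption on \<epsilon> by
    0.88 cancels 3/88 against 0.03 and leaves 9.28 = 0.88 * 116/11. Then 1.16/9.28 = 1/8 bounds
    \<open>a * sqrt q\<close>.\<close>
  define g where "g = (88 / 100) * (w / w') - 3 / 100"
  have g: "(928 / 100) * sqrt q \<le> g"
    using assms(14) unfolding ratio q_def[symmetric] g_def by simp
  have sq0: "0 < sqrt q" using q0 by simp
  have g0: "0 < g" using g sq0 by linarith
  have ag: "a = (116 / 100) / g"
    unfolding a ratio g_def by simp
  have a0: "0 < a" using g0 by (simp add: ag)
  have a1: "(116 / 100) / w \<le> a * ((88 / 100) / w' - (3 / 100) / w)"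
  proof -
    have "(88 / 100) / w' - (3 / 100) / w = g / w"
      using w w' by (simp add: g_def field_simps)
    then show ?thesis using g0 by (simp add: ag)
  qed
  have a2: "(3 / 100) / w < (88 / 100) / w'"
    using g0 w w' by (simp add: g_def field_simps)
  have "a * ((928 / 100) * sqrt q) \<le> a * g"
    using g a0 by (intro mult_left_mono) auto
  moreover have "a * g = 116 / 100"
    using g0 by (simp add: ag)
  ultimately have "a * sqrt q \<le> 1 / 8"
    by simp
  then have "(a * sqrt q)\<^sup>2 \<le> (1 / 8)\<^sup>2"
    using a0 q0 by (intro power_mono) auto
  then have a3: "a\<^sup>2 * q \<le> 1 / 64"
    using q0 by (simp add: power_mult_distrib power2_eq_square[of "8::real"] power_divide)
  \<comment> \<open>The range of \<open>X\<close> is a fixed subspace of dimension \<open>n\<close>,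
    because \<open>X\<close> has full column rank.\<close>
  let ?K = "range ((*v) X)"
  define S where "S = {\<omega> \<in> space M. subspace_embedding \<epsilon> (\<Omega> \<omega>) ?K}"
  have "subspace ?K"
    by (simp add: linear_subspace_image subspace_UNIV)
  moreover have "dim ?K = n"
    using assms(8) by (simp add: rank_dim_range)
  ultimately have S: "1 - p \<le> measure M S"
    using assms(13) unfolding oblivious_subspace_embedding_def S_def by blast
  have bound: "norm (transpose Q ** Q - mat 1) \<le> d \<and> norm (Q ** R - X) \<le> b \<omega> * spectral_norm X"
    if "\<omega> \<in> S" and alg: "fl_RCholeskyQR2 (\<Omega> \<omega>) X Q R" and \<kappa>: "kappa2 X \<le> \<delta>1 \<omega>" for \<omega> Q R
  proof -
    define F where "F = frobenius_norm (\<Omega> \<omega>)"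
    have F: "0 \<le> F" by (simp add: F_def)
    have emb: "w * norm (X *v z) \<le> norm (\<Omega> \<omega> *v (X *v z))"
      "norm (\<Omega> \<omega> *v (X *v z)) \<le> w' * norm (X *v z)" for z
    proof -
      \<comment> \<open>The embedding property with both vectors equal gives the two-sided
        distortion bound.\<close>
      have "\<bar>(X *v z) \<bullet> (X *v z) - (\<Omega> \<omega> *v (X *v z)) \<bullet> (\<Omega> \<omega> *v (X *v z))\<bar>
          \<le> \<epsilon> * norm (X *v z) * norm (X *v z)"
        using that(1) unfolding S_def subspace_embedding_def by blast
      then have "\<bar>(norm (X *v z))\<^sup>2 - (norm (\<Omega> \<omega> *v (X *v z)))\<^sup>2\<bar> \<le> \<epsilon> * (norm (X *v z))\<^sup>2"
        by (simp only: power2_norm_eq_inner[symmetric] power2_eq_square mult.assoc)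
      then have "(1 - \<epsilon>) * (norm (X *v z))\<^sup>2 \<le> (norm (\<Omega> \<omega> *v (X *v z)))\<^sup>2"
        and "(norm (\<Omega> \<omega> *v (X *v z)))\<^sup>2 \<le> (1 + \<epsilon>) * (norm (X *v z))\<^sup>2"
        unfolding left_diff_distrib distrib_right by linarith+
      then have "(w * norm (X *v z))\<^sup>2 \<le> (norm (\<Omega> \<omega> *v (X *v z)))\<^sup>2"
        and "(norm (\<Omega> \<omega> *v (X *v z)))\<^sup>2 \<le> (w' * norm (X *v z))\<^sup>2"
        by (simp_all add: power_mult_distrib w w')
      then show "w * norm (X *v z) \<le> norm (\<Omega> \<omega> *v (X *v z))"
        and "norm (\<Omega> \<omega> *v (X *v z)) \<le> w' * norm (X *v z)"
        using w(1) w'(1) by (auto intro: power2_le_imp_le)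
    qed
    define f where "f = w' + (102 / 100) * real m * u * F"
    have f: "0 < f" using w' u0 F by (simp add: f_def add_pos_nonneg)
    have k': "k \<omega> = (102 / 100) * real m * u * F * j"
      by (simp add: k F_def)
    have k_nonneg: "0 \<le> k \<omega>" unfolding k' using u0 F j0 by simp
    define H where "H = real s * u + (real n + 1) * u"
    have H: "0 < H" using u0 by (simp add: H_def add_nonneg_pos)
    have \<kappa>1: "N / \<sigma> \<le> w / ((21 / 2) * k \<omega>)"
      and \<kappa>2: "N / \<sigma> \<le> 1 / ((21 / 2) * j * f) * sqrt ((1 - \<epsilon>) / H)"
      using \<kappa> unfolding \<delta>1 kappa2_def N_def[symmetric] \<sigma>_def[symmetric] w_def f_def w'_def F_def H_def
      by (simp_all)
    \<comment> \<open>Division by zero yields 0, so \<open>k \<omega> = 0\<close> would contradict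
      the positive lower bound \<open>N / \<sigma>\<close>.\<close>
    have "0 < w / ((21 / 2) * k \<omega>)"
      using \<kappa>1 N \<sigma> by (meson divide_pos_pos less_le_trans)
    with k_nonneg have k0: "0 < k \<omega>"
      using w by (cases "k \<omega> = 0") auto
    have kN: "k \<omega> * N = (102 / 100) * real m * u * F * J"
      by (simp add: k' jN[symmetric])
    \<comment> \<open>Clearing denominators with \<open>j * N = J\<close> turns the first term of
      the minimum into the hypothesis on \<open>e\<close>; the second term gives the one on \<alpha>
      after squaring.\<close>
    have "21 * (k \<omega> * N) \<le> 2 * (w * \<sigma>)"
      using \<kappa>1 k0 \<sigma> by (simp add: field_simps)
    then have e: "21 * ((102 / 100) * real m * u * F * J) \<le> 2 * (w * \<sigma>)"
      unfolding kN .
    have wH: "sqrt ((1 - \<epsilon>) / H) = w / sqrt H"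
      by (simp add: w_def real_sqrt_divide)
    have "21 * (f * (j * N)) * sqrt H \<le> 2 * (w * \<sigma>)"
      using \<kappa>2[unfolded wH] j0 f H \<sigma> by (simp add: field_simps)
    then have "(21 * (f * J) * sqrt H)\<^sup>2 \<le> (2 * (w * \<sigma>))\<^sup>2"
      unfolding jN using f J0 H by (intro power_mono) auto
    then have \<alpha>: "(21 * (f * J))\<^sup>2 * ((real s + (real n + 1)) * u) \<le> (2 * (w * \<sigma>))\<^sup>2"
      using H by (simp add: power_mult_distrib H_def distrib_right)
    have sm: "real s \<le> real m" and ns: "real n \<le> real s" using assms(4,5) by simp_all
    note err = RCholeskyQR2_error[OF alg, folded dims u F_def, OF assms(15,16) ns sm w(1) emb(1) w'(1) emb(2) \<sigma> XJ,
        folded f_def q_def, OF e \<alpha> a1 a2 a3]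
    have "norm (transpose Q ** Q - mat 1) \<le> d"
      using err(1) by (simp add: d q_def)
    moreover have "norm (Q ** R - X)
      \<le> ((122 / 100) + (124 / 100) * sqrt (1 + d)) / w * (f * J) * (real n * sqrt (real n) * u)
        + (124 / 100) * sqrt (1 + d) / w * (w' * N + k \<omega> * N) * ((real n)\<^sup>2 * u)"
      using err(2) by (simp only: d q_def N_def kN[unfolded N_def])
    moreover have "\<dots> = b \<omega> * N"
      unfolding b w_def[symmetric] w'_def[symmetric] F_def[symmetric] jN[symmetric] f_def
      by (simp add: algebra_simps add_divide_distrib)
    ultimately show ?thesis by (simp add: N_def)
  qed
  show ?thesis
  proof (cases "S \<in> sets M")
    case True
    with S bound show ?thesis by blast
  next
    case False
    \<comment> \<open>Non-measurable sets have measure 0 by convention, so the claim is trivial.\<close>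
    then have "1 - p \<le> 0" using S by (simp add: measure_notin_sets)
    then show ?thesis by (intro bexI[of _ "{}"]) auto
  qed
qed

end
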